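(* Let $\mathscr{C}$ be a pivotal $\Bbbk$-category over an integral domain $\Bbbk$, with unit object $\mathbf 1$. Suppose $(P,\alpha,\beta,\eta,\epsilon)$ is a trace tuple with $P\in I_\alpha^\beta$, and let $\mathsf{t}$ be the associated right $(\alpha,\beta)$-trace on $I_\alpha^\beta$. (1) If $\beta=\mathbf 1$, then the right $(\alpha,\mathbf 1)$-trace on $I_\alpha^{\mathbf 1}$ is unique up to a scalar. Specifically, if $\mathsf{t}'$ is a right $(\alpha,\mathbf 1)$-trace on $I_\alpha^{\mathbf 1}$, then $\mathsf{t}'=\mathsf{t}'_P(\eta\otimes\epsilon)\,\mathsf{t}$. Moreover, $\mathsf{t}_P(\eta\otimes\epsilon)=1$. (2) If $\alpha=\mathbf 1$, then the right $(\mathbf 1,\beta)$-trace on $I_{\mathbf 1}^\beta$ is unique up to a scalar. Specifically, if $\mathsf{t}'$ is a right $(\mathbf 1,\beta)$-trace on $I_{\mathbf 1}^{\beta}$, then $\mathsf{t}'=\mathsf{t}'_P(\epsilon\otimes\eta)\,\mathsf{t}$. Moreover, $\mathsf{t}_P(\epsilon\otimes\eta)=1$.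
   Context: Composition of morphisms is written $fg=f\circ g$. A pivotal $\Bbbk$-category is a strict monoidal category $\mathscr{C}$ that is additive, with hom-sets $\Bbbk$-modules and with $\Bbbk$-bilinear composition and tensor product, such that $\Bbbk\to\operatorname{End}_{\mathscr{C}}(\mathbf{1})$, $k\mapsto k\operatorname{Id}_{\mathbf 1}$, is an isomorphism, and such that each object $V$ has a dual $V^*$ with morphisms $\operatorname{coev}_V:\mathbf 1\to V\otimes V^*$, $\operatorname{ev}_V:V^*\otimes V\to\mathbf 1$ (left duality) and $\widetilde{\operatorname{coev}}_V:\mathbf 1\to V^*\otimes V$, $\widetilde{\operatorname{ev}}_V:V\otimes V^*\to\mathbf 1$ (right duality) satisfying the zig-zag identities, for which the left and right duals of each morphism coincide and the two canonical isomorphisms $W^*\otimes V^*\to (V\otimes W)^*$ obtained from the left and right duality coincide (these isomorphisms are taken to be identities). Right ideal: a full subcategory $I$ such that (i) $V\in I$, $W\in\mathscr{C}$ imply $V\otimes W\in I$; (ii) if $V\in I$ and there are $f:W\to V$, $g:V\to W$ with $gf=\operatorname{Id}_W$, then $W\in I$. Right partial trace: for $g\in\operatorname{Hom}_{\mathscr{C}}(V\otimes W,X\otimes W)$, $\operatorname{tr}_r^W(g)=(\operatorname{Id}_X\otimes\widetilde{\operatorname{ev}}_W)(g\otimes\operatorname{Id}_{W^*})(\operatorname{Id}_V\otimes\operatorname{coev}_W)\in\operatorname{Hom}_{\mathscr{C}}(V,X)$. Right $(\alpha,\beta)$-trace on a right ideal $I$: a family of $\Bbbk$-linear maps $\mathsf{t}_V:\operatorname{Hom}_{\mathscr{C}}(\alpha\otimes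 V,\beta\otimes V)\to\Bbbk$, $V\in I$, with (1) $\mathsf{t}_{U\otimes W}(f)=\mathsf{t}_U(\operatorname{tr}_r^W(f))$ for $U\in I$, $W\in\mathscr{C}$, $f:\alpha\otimes U\otimes W\to\beta\otimes U\otimes W$; (2) $\mathsf{t}_V((\operatorname{Id}_\beta\otimes g)f)=\mathsf{t}_U(f(\operatorname{Id}_\alpha\otimes g))$ for $U,V\in I$, $f:\alpha\otimes V\to\beta\otimes U$, $g:U\to V$. An object $V$ is absolutely indecomposable if $\operatorname{End}_{\mathscr{C}}(V)/\operatorname{J}(\operatorname{End}_{\mathscr{C}}(V))\cong\Bbbk$, where $\operatorname{J}$ is the Jacobson radical; it is moreover end-nilpotent if $\operatorname{J}(\operatorname{End}_{\mathscr{C}}(V))$ is nilpotent. Trace tuple: $(P,\alpha,\beta,\eta,\epsilon)$ with $P,\alpha,\beta$ objects and $\eta:\alpha\to P$, $\epsilon:P\to\beta$ nonzero morphisms such that $P$ is absolutely indecomposable and end-nilpotent, and $\operatorname{Hom}_{\mathscr{C}}(\alpha,P)$, $\operatorname{Hom}_{\mathscr{C}}(P,\beta)$ are free $\Bbbk$-modules generated by $\eta$ and $\epsilon$ respectively. For a trace tuple: $I_\alpha$ is the class (full subcategory) of objects $V$ for which there is $\sigma_V:P\otimes V\to\alpha\otimes V$ with $\sigma_V(\eta\otimes\operatorname{Id}_V)=\operatorname{Id}_{\alpha\otimes V}$; $I^\beta$ that of objects $V$ for which there is $\tau_V:\beta\otimes V\to P\otimes V$ with $(\epsilon\otimes\operatorname{Id}_V)\tau_V=\operatorname{Id}_{\beta\otimes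 V}$; and $I_\alpha^\beta=I_\alpha\cap I^\beta$, a right ideal. For $g\in\operatorname{Hom}_{\mathscr{C}}(\alpha,P)$ and $h\in\operatorname{Hom}_{\mathscr{C}}(P,\beta)$, the scalars $\langle g\rangle_\eta,\langle h\rangle_\epsilon\in\Bbbk$ are defined by $g=\langle g\rangle_\eta\,\eta$ and $h=\langle h\rangle_\epsilon\,\epsilon$. The right $(\alpha,\beta)$-trace associated to the trace tuple is $\mathsf{t}_V(f)=\langle \operatorname{tr}_r^V(\tau_V f)\rangle_\eta=\langle \operatorname{tr}_r^V(f\sigma_V)\rangle_\epsilon$ for $V\in I_\alpha^\beta$ and $f\in\operatorname{Hom}_{\mathscr{C}}(\alpha\otimes V,\beta\otimes V)$, which is a well-defined right $(\alpha,\beta)$-trace on $I_\alpha^\beta$ independent of the choice of morphisms $\sigma_V:P\otimes V\to\alpha\otimes V$ and $\tau_V:\beta\otimes V\to P\otimes V$ satisfying $\sigma_V(\eta\otimes\operatorname{Id}_V)=\operatorname{Id}_{\alpha\otimes V}$ and $(\epsilon\otimes\operatorname{Id}_V)\tau_V=\operatorname{Id}_{\beta\otimes V}$. *)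

theory Defs
  imports "HOL-Algebra.Module" "HOL-Algebra.QuotRing" "HOL-Algebra.Ideal_Product"
begin

section \<open>The Jacobson radical of a not necessarily commutative ring\<close>

definition left_ideal :: "('a, 'b) ring_scheme \<Rightarrow> 'a set \<Rightarrow> bool" where
  "left_ideal R I \<longleftrightarrow>
     additive_subgroup I R \<and> (\<forall>a\<in>carrier R. \<forall>x\<in>I. a \<otimes>\<^bsub>R\<^esub> x \<in> I)"

definition maximal_left_ideal :: "('a, 'b) ring_scheme \<Rightarrow> 'a set \<Rightarrow> bool" where
  "maximal_left_ideal R I \<longleftrightarrow>
     left_ideal R I \<and> I \<noteq> carrier R \<and>
     (\<forall>J. left_ideal R J \<and> I \<subseteq> J \<longrightarrow> J = I \<or> J = carrier R)"

definition jacobson_radical :: "('a, 'b) ring_scheme \<Rightarrow> 'a set" where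
  "jacobson_radical R = carrier R \<inter> \<Inter>{I. maximal_left_ideal R I}"

definition nilpotent_ideal :: "('a, 'b) ring_scheme \<Rightarrow> 'a set \<Rightarrow> bool" where
  "nilpotent_ideal R J \<longleftrightarrow> (\<exists>n::nat. (ideal_prod R J ^^ n) (carrier R) = {\<zero>\<^bsub>R\<^esub>})"


section \<open>Pivotal linear categories\<close>

text \<open>
  The objects are the elements of the type \<open>'o\<close>; the morphisms from \<open>V\<close> to \<open>W\<close> are the
  elements of \<open>carrier (Hom V W)\<close>, where \<open>Hom V W\<close> is a module in the sense of HOL-Algebra
  whose ring fields \<open>mult\<close> and \<open>one\<close> carry no meaning.  The composite \<open>f \<bullet> g\<close> is
  \<open>f\<close> after \<open>g\<close>.  Composition and tensor product of morphisms are only constrained on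
  matching hom-sets.
\<close>

record ('o, 'm, 'k) pivotal_data =
  Hom :: "'o \<Rightarrow> 'o \<Rightarrow> ('k, 'm) module"
  Ident :: "'o \<Rightarrow> 'm"
  Comp :: "'m \<Rightarrow> 'm \<Rightarrow> 'm"  (infixl "\<bullet>\<index>" 65)
  Unit :: 'o  ("\<I>\<index>")
  TensO :: "'o \<Rightarrow> 'o \<Rightarrow> 'o"  (infixr "\<otimes>\<^sub>o\<index>" 72)
  TensM :: "'m \<Rightarrow> 'm \<Rightarrow> 'm"  (infixr "\<otimes>\<^sub>m\<index>" 72)
  Dual :: "'o \<Rightarrow> 'o"
  Coev :: "'o \<Rightarrow> 'm"
  Ev :: "'o \<Rightarrow> 'm"
  Coev' :: "'o \<Rightarrow> 'm"
  Ev' :: "'o \<Rightarrow> 'm"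

abbreviation mor :: "('o, 'm, 'k) pivotal_data \<Rightarrow> 'o \<Rightarrow> 'o \<Rightarrow> 'm set" where
  "mor C V W \<equiv> carrier (Hom C V W)"

definition End_ring :: "('o, 'm, 'k) pivotal_data \<Rightarrow> 'o \<Rightarrow> ('k, 'm) module" where
  "End_ring C V = (Hom C V V)\<lparr>mult := Comp C, one := Ident C V\<rparr>"

locale linear_category =
  fixes K :: "('k, 'r) ring_scheme" and C :: "('o, 'm, 'k) pivotal_data" (structure)
  assumes Hom_module: "module K (Hom C V W)"
    and Ident_mor: "Ident C V \<in> mor C V V"
    and Comp_mor: "\<lbrakk>f \<in> mor C W X; g \<in> mor C V W\<rbrakk> \<Longrightarrow> f \<bullet> g \<in> mor C V X"
    and Comp_Ident_left: "f \<in> mor C V W \<Longrightarrow> Ident C W \<bullet> f = f"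
    and Comp_Ident_right: "f \<in> mor C V W \<Longrightarrow> f \<bullet> Ident C V = f"
    and Comp_assoc: "\<lbrakk>f \<in> mor C X Y; g \<in> mor C W X; h \<in> mor C V W\<rbrakk>
        \<Longrightarrow> (f \<bullet> g) \<bullet> h = f \<bullet> (g \<bullet> h)"
    and Comp_add_left: "\<lbrakk>f \<in> mor C W X; f' \<in> mor C W X; g \<in> mor C V W\<rbrakk>
        \<Longrightarrow> (f \<oplus>\<^bsub>Hom C W X\<^esub> f') \<bullet> g = (f \<bullet> g) \<oplus>\<^bsub>Hom C V X\<^esub> (f' \<bullet> g)"
    and Comp_add_right: "\<lbrakk>f \<in> mor C W X; g \<in> mor C V W; g' \<in> mor C V W\<rbrakk>
        \<Longrightarrow> f \<bullet> (g \<oplus>\<^bsub>Hom C V W\<^esub> g') = (f \<bullet> g) \<oplus>\<^bsub>Hom C V X\<^esub> (f \<bullet> g')"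
    and Comp_smult_left: "\<lbrakk>c \<in> carrier K; f \<in> mor C W X; g \<in> mor C V W\<rbrakk>
        \<Longrightarrow> (c \<odot>\<^bsub>Hom C W X\<^esub> f) \<bullet> g = c \<odot>\<^bsub>Hom C V X\<^esub> (f \<bullet> g)"
    and Comp_smult_right: "\<lbrakk>c \<in> carrier K; f \<in> mor C W X; g \<in> mor C V W\<rbrakk>
        \<Longrightarrow> f \<bullet> (c \<odot>\<^bsub>Hom C V W\<^esub> g) = c \<odot>\<^bsub>Hom C V X\<^esub> (f \<bullet> g)"

locale additive_category = linear_category K C
  for K :: "('k, 'r) ring_scheme" and C :: "('o, 'm, 'k) pivotal_data" (structure) +
  assumes zero_object: "\<exists>Z. \<forall>X. (\<exists>!f. f \<in> mor C Z X) \<and> (\<exists>!f. f \<in> mor C X Z)"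
    and biproduct: "\<exists>S. \<exists>i\<in>mor C V S. \<exists>j\<in>mor C W S. \<exists>p\<in>mor C S V. \<exists>q\<in>mor C S W.
        p \<bullet> i = Ident C V \<and> q \<bullet> j = Ident C W \<and>
        p \<bullet> j = \<zero>\<^bsub>Hom C W V\<^esub> \<and> q \<bullet> i = \<zero>\<^bsub>Hom C V W\<^esub> \<and>
        (i \<bullet> p) \<oplus>\<^bsub>Hom C S S\<^esub> (j \<bullet> q) = Ident C S"

locale monoidal_linear_category = additive_category K C
  for K :: "('k, 'r) ring_scheme" and C :: "('o, 'm, 'k) pivotal_data" (structure) +
  assumes TensO_assoc: "(V \<otimes>\<^sub>o W) \<otimes>\<^sub>o X = V \<otimes>\<^sub>o (W \<otimes>\<^sub>o X)"
    and TensO_Unit_left: "\<I> \<otimes>\<^sub>o V = V"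
    and TensO_Unit_right: "V \<otimes>\<^sub>o \<I> = V"
    and TensM_mor: "\<lbrakk>f \<in> mor C V W; g \<in> mor C X Y\<rbrakk>
        \<Longrightarrow> f \<otimes>\<^sub>m g \<in> mor C (V \<otimes>\<^sub>o X) (W \<otimes>\<^sub>o Y)"
    and TensM_assoc: "\<lbrakk>f \<in> mor C V W; g \<in> mor C X Y; h \<in> mor C S T\<rbrakk>
        \<Longrightarrow> (f \<otimes>\<^sub>m g) \<otimes>\<^sub>m h = f \<otimes>\<^sub>m (g \<otimes>\<^sub>m h)"
    and TensM_Unit_left: "f \<in> mor C V W \<Longrightarrow> Ident C \<I> \<otimes>\<^sub>m f = f"
    and TensM_Unit_right: "f \<in> mor C V W \<Longrightarrow> f \<otimes>\<^sub>m Ident C \<I> = f"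
    and TensM_Ident: "Ident C V \<otimes>\<^sub>m Ident C W = Ident C (V \<otimes>\<^sub>o W)"
    and TensM_Comp:
      "\<lbrakk>f \<in> mor C W X; g \<in> mor C V W; f' \<in> mor C W' X'; g' \<in> mor C V' W'\<rbrakk>
        \<Longrightarrow> (f \<bullet> g) \<otimes>\<^sub>m (f' \<bullet> g') = (f \<otimes>\<^sub>m f') \<bullet> (g \<otimes>\<^sub>m g')"
    and TensM_add_left: "\<lbrakk>f \<in> mor C V W; f' \<in> mor C V W; g \<in> mor C X Y\<rbrakk>
        \<Longrightarrow> (f \<oplus>\<^bsub>Hom C V W\<^esub> f') \<otimes>\<^sub>m g =
          (f \<otimes>\<^sub>m g) \<oplus>\<^bsub>Hom C (V \<otimes>\<^sub>o X) (W \<otimes>\<^sub>o Y)\<^esub> (f' \<otimes>\<^sub>m g)"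
    and TensM_add_right: "\<lbrakk>f \<in> mor C V W; g \<in> mor C X Y; g' \<in> mor C X Y\<rbrakk>
        \<Longrightarrow> f \<otimes>\<^sub>m (g \<oplus>\<^bsub>Hom C X Y\<^esub> g') =
          (f \<otimes>\<^sub>m g) \<oplus>\<^bsub>Hom C (V \<otimes>\<^sub>o X) (W \<otimes>\<^sub>o Y)\<^esub> (f \<otimes>\<^sub>m g')"
    and TensM_smult_left: "\<lbrakk>c \<in> carrier K; f \<in> mor C V W; g \<in> mor C X Y\<rbrakk>
        \<Longrightarrow> (c \<odot>\<^bsub>Hom C V W\<^esub> f) \<otimes>\<^sub>m g =
          c \<odot>\<^bsub>Hom C (V \<otimes>\<^sub>o X) (W \<otimes>\<^sub>o Y)\<^esub> (f \<otimes>\<^sub>m g)"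
    and TensM_smult_right: "\<lbrakk>c \<in> carrier K; f \<in> mor C V W; g \<in> mor C X Y\<rbrakk>
        \<Longrightarrow> f \<otimes>\<^sub>m (c \<odot>\<^bsub>Hom C X Y\<^esub> g) =
          c \<odot>\<^bsub>Hom C (V \<otimes>\<^sub>o X) (W \<otimes>\<^sub>o Y)\<^esub> (f \<otimes>\<^sub>m g)"
    and scalars_End_Unit:
      "(\<lambda>c. c \<odot>\<^bsub>Hom C \<I> \<I>\<^esub> Ident C \<I>) \<in> ring_iso K (End_ring C \<I>)"

context
  fixes C :: "('o, 'm, 'k) pivotal_data" (structure)
begin

text \<open>The two duals \<open>W\<^sup>* \<rightarrow> V\<^sup>*\<close> of a morphism \<open>f : V \<rightarrow> W\<close>.\<close>

definition left_dual :: "'o \<Rightarrow> 'o \<Rightarrow> 'm \<Rightarrow> 'm" where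
  "left_dual V W f =
     (Ev C W \<otimes>\<^sub>m Ident C (Dual C V))
     \<bullet> (Ident C (Dual C W) \<otimes>\<^sub>m f \<otimes>\<^sub>m Ident C (Dual C V))
     \<bullet> (Ident C (Dual C W) \<otimes>\<^sub>m Coev C V)"

definition right_dual :: "'o \<Rightarrow> 'o \<Rightarrow> 'm \<Rightarrow> 'm" where
  "right_dual V W f =
     (Ident C (Dual C V) \<otimes>\<^sub>m Ev' C W)
     \<bullet> (Ident C (Dual C V) \<otimes>\<^sub>m f \<otimes>\<^sub>m Ident C (Dual C W))
     \<bullet> (Coev' C V \<otimes>\<^sub>m Ident C (Dual C W))"

text \<open>The two canonical isomorphisms \<open>W\<^sup>* \<otimes> V\<^sup>* \<rightarrow> (V \<otimes> W)\<^sup>*\<close>.\<close>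

definition left_dual_tens :: "'o \<Rightarrow> 'o \<Rightarrow> 'm" where
  "left_dual_tens V W =
     (Ev C W \<otimes>\<^sub>m Ident C (Dual C (V \<otimes>\<^sub>o W)))
     \<bullet> (Ident C (Dual C W) \<otimes>\<^sub>m Ev C V \<otimes>\<^sub>m Ident C (W \<otimes>\<^sub>o Dual C (V \<otimes>\<^sub>o W)))
     \<bullet> (Ident C (Dual C W \<otimes>\<^sub>o Dual C V) \<otimes>\<^sub>m Coev C (V \<otimes>\<^sub>o W))"

definition right_dual_tens :: "'o \<Rightarrow> 'o \<Rightarrow> 'm" where
  "right_dual_tens V W =
     (Ident C (Dual C (V \<otimes>\<^sub>o W)) \<otimes>\<^sub>m Ev' C V)
     \<bullet> (Ident C (Dual C (V \<otimes>\<^sub>o W) \<otimes>\<^sub>o V) \<otimes>\<^sub>m Ev' C W \<otimes>\<^sub>m Ident C (Dual C V))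
     \<bullet> (Coev' C (V \<otimes>\<^sub>o W) \<otimes>\<^sub>m Ident C (Dual C W \<otimes>\<^sub>o Dual C V))"

end

text \<open>
  The common value of the two canonical isomorphisms is not required to be an identity:
  treating it as one is a notational convention, and every strictly pivotal category is
  covered.
\<close>

locale pivotal_category = monoidal_linear_category K C
  for K :: "('k, 'r) ring_scheme" and C :: "('o, 'm, 'k) pivotal_data" (structure) +
  assumes Coev_mor: "Coev C V \<in> mor C \<I> (V \<otimes>\<^sub>o Dual C V)"
    and Ev_mor: "Ev C V \<in> mor C (Dual C V \<otimes>\<^sub>o V) \<I>"
    and Coev'_mor: "Coev' C V \<in> mor C \<I> (Dual C V \<otimes>\<^sub>o V)"
    and Ev'_mor: "Ev' C V \<in> mor C (V \<otimes>\<^sub>o Dual C V) \<I>"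
    and zigzag_left:
      "(Ident C V \<otimes>\<^sub>m Ev C V) \<bullet> (Coev C V \<otimes>\<^sub>m Ident C V) = Ident C V"
      "(Ev C V \<otimes>\<^sub>m Ident C (Dual C V)) \<bullet> (Ident C (Dual C V) \<otimes>\<^sub>m Coev C V)
        = Ident C (Dual C V)"
    and zigzag_right:
      "(Ev' C V \<otimes>\<^sub>m Ident C V) \<bullet> (Ident C V \<otimes>\<^sub>m Coev' C V) = Ident C V"
      "(Ident C (Dual C V) \<otimes>\<^sub>m Ev' C V) \<bullet> (Coev' C V \<otimes>\<^sub>m Ident C (Dual C V))
        = Ident C (Dual C V)"
    and duals_coincide: "f \<in> mor C V W \<Longrightarrow> left_dual C V W f = right_dual C V W f"
    and dual_tens_coincide: "left_dual_tens C V W = right_dual_tens C V W"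


section \<open>Right ideals and right traces\<close>

context
  fixes C :: "('o, 'm, 'k) pivotal_data" (structure)
begin

definition right_ideal :: "'o set \<Rightarrow> bool" where
  "right_ideal I \<longleftrightarrow>
     (\<forall>V\<in>I. \<forall>W. V \<otimes>\<^sub>o W \<in> I) \<and>
     (\<forall>V\<in>I. \<forall>W. (\<exists>f\<in>mor C W V. \<exists>g\<in>mor C V W. g \<bullet> f = Ident C W) \<longrightarrow> W \<in> I)"

text \<open>\<open>partial_trace V X W g\<close> is the right partial trace over \<open>W\<close> of
  \<open>g : V \<otimes> W \<rightarrow> X \<otimes> W\<close>.\<close>

definition partial_trace :: "'o \<Rightarrow> 'o \<Rightarrow> 'o \<Rightarrow> 'm \<Rightarrow> 'm" where
  "partial_trace V X W g =
     (Ident C X \<otimes>\<^sub>m Ev' C W) \<bullet> (g \<otimes>\<^sub>m Ident C (Dual C W)) \<bullet> (Ident C V \<otimes>\<^sub>m Coev C W)"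

end

context
  fixes K :: "('k, 'r) ring_scheme" and C :: "('o, 'm, 'k) pivotal_data" (structure)
begin

definition right_trace :: "'o \<Rightarrow> 'o \<Rightarrow> 'o set \<Rightarrow> ('o \<Rightarrow> 'm \<Rightarrow> 'k) \<Rightarrow> bool" where
  "right_trace \<alpha> \<beta> I t \<longleftrightarrow>
     right_ideal C I \<and>
     (\<forall>V\<in>I. \<forall>f\<in>mor C (\<alpha> \<otimes>\<^sub>o V) (\<beta> \<otimes>\<^sub>o V). t V f \<in> carrier K) \<and>
     (\<forall>V\<in>I. \<forall>f\<in>mor C (\<alpha> \<otimes>\<^sub>o V) (\<beta> \<otimes>\<^sub>o V). \<forall>g\<in>mor C (\<alpha> \<otimes>\<^sub>o V) (\<beta> \<otimes>\<^sub>o V).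
        t V (f \<oplus>\<^bsub>Hom C (\<alpha> \<otimes>\<^sub>o V) (\<beta> \<otimes>\<^sub>o V)\<^esub> g) = t V f \<oplus>\<^bsub>K\<^esub> t V g) \<and>
     (\<forall>V\<in>I. \<forall>c\<in>carrier K. \<forall>f\<in>mor C (\<alpha> \<otimes>\<^sub>o V) (\<beta> \<otimes>\<^sub>o V).
        t V (c \<odot>\<^bsub>Hom C (\<alpha> \<otimes>\<^sub>o V) (\<beta> \<otimes>\<^sub>o V)\<^esub> f) = c \<otimes>\<^bsub>K\<^esub> t V f) \<and>
     (\<forall>U\<in>I. \<forall>W. \<forall>f\<in>mor C (\<alpha> \<otimes>\<^sub>o U \<otimes>\<^sub>o W) (\<beta> \<otimes>\<^sub>o U \<otimes>\<^sub>o W).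
        t (U \<otimes>\<^sub>o W) f = t U (partial_trace C (\<alpha> \<otimes>\<^sub>o U) (\<beta> \<otimes>\<^sub>o U) W f)) \<and>
     (\<forall>U\<in>I. \<forall>V\<in>I. \<forall>f\<in>mor C (\<alpha> \<otimes>\<^sub>o V) (\<beta> \<otimes>\<^sub>o U). \<forall>g\<in>mor C U V.
        t V ((Ident C \<beta> \<otimes>\<^sub>m g) \<bullet> f) = t U (f \<bullet> (Ident C \<alpha> \<otimes>\<^sub>m g)))"


section \<open>Trace tuples\<close>

text \<open>
  The isomorphism of \<open>End V / J\<close> with the ground ring is one of algebras: the scalar \<open>c\<close> acts
  on the class \<open>J + x\<close> by sending it to the class of \<open>c \<odot> x\<close>.
\<close>

definition absolutely_indecomposable :: "'o \<Rightarrow> bool" where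
  "absolutely_indecomposable V \<longleftrightarrow>
     (let E = End_ring C V; J = jacobson_radical E in
      \<exists>\<phi>\<in>ring_iso (E Quot J) K.
        \<forall>c\<in>carrier K. \<forall>x\<in>carrier E. \<phi> (J +>\<^bsub>E\<^esub> (c \<odot>\<^bsub>E\<^esub> x)) = c \<otimes>\<^bsub>K\<^esub> \<phi> (J +>\<^bsub>E\<^esub> x))"

definition end_nilpotent :: "'o \<Rightarrow> bool" where
  "end_nilpotent V \<longleftrightarrow> nilpotent_ideal (End_ring C V) (jacobson_radical (End_ring C V))"

definition freely_generated_by :: "('k, 'm) module \<Rightarrow> 'm \<Rightarrow> bool" where
  "freely_generated_by M x \<longleftrightarrow>
     x \<in> carrier M \<and> (\<forall>y\<in>carrier M. \<exists>!c. c \<in> carrier K \<and> y = c \<odot>\<^bsub>M\<^esub> x)"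

definition coordinate :: "('k, 'm) module \<Rightarrow> 'm \<Rightarrow> 'm \<Rightarrow> 'k" where
  "coordinate M x y = (THE c. c \<in> carrier K \<and> y = c \<odot>\<^bsub>M\<^esub> x)"

definition trace_tuple :: "'o \<Rightarrow> 'o \<Rightarrow> 'o \<Rightarrow> 'm \<Rightarrow> 'm \<Rightarrow> bool" where
  "trace_tuple P \<alpha> \<beta> \<eta> \<epsilon> \<longleftrightarrow>
     \<eta> \<in> mor C \<alpha> P \<and> \<eta> \<noteq> \<zero>\<^bsub>Hom C \<alpha> P\<^esub> \<and>
     \<epsilon> \<in> mor C P \<beta> \<and> \<epsilon> \<noteq> \<zero>\<^bsub>Hom C P \<beta>\<^esub> \<and>
     absolutely_indecomposable P \<and> end_nilpotent P \<and>
     freely_generated_by (Hom C \<alpha> P) \<eta> \<and> freely_generated_by (Hom C P \<beta>) \<epsilon>"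

end

context
  fixes C :: "('o, 'm, 'k) pivotal_data" (structure)
begin

text \<open>The admissible choices of \<open>\<sigma>\<^sub>V\<close> and of \<open>\<tau>\<^sub>V\<close>.\<close>

definition sigmas :: "'o \<Rightarrow> 'o \<Rightarrow> 'm \<Rightarrow> 'o \<Rightarrow> 'm set" where
  "sigmas P \<alpha> \<eta> V =
     {\<sigma> \<in> mor C (P \<otimes>\<^sub>o V) (\<alpha> \<otimes>\<^sub>o V). \<sigma> \<bullet> (\<eta> \<otimes>\<^sub>m Ident C V) = Ident C (\<alpha> \<otimes>\<^sub>o V)}"

definition taus :: "'o \<Rightarrow> 'o \<Rightarrow> 'm \<Rightarrow> 'o \<Rightarrow> 'm set" where
  "taus P \<beta> \<epsilon> V =
     {\<tau> \<in> mor C (\<beta> \<otimes>\<^sub>o V) (P \<otimes>\<^sub>o V). (\<epsilon> \<otimes>\<^sub>m Ident C V) \<bullet> \<tau> = Ident C (\<beta> \<otimes>\<^sub>o V)}"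

definition lower_ideal :: "'o \<Rightarrow> 'o \<Rightarrow> 'm \<Rightarrow> 'o set" where
  "lower_ideal P \<alpha> \<eta> = {V. sigmas P \<alpha> \<eta> V \<noteq> {}}"

definition upper_ideal :: "'o \<Rightarrow> 'o \<Rightarrow> 'm \<Rightarrow> 'o set" where
  "upper_ideal P \<beta> \<epsilon> = {V. taus P \<beta> \<epsilon> V \<noteq> {}}"

definition tuple_ideal :: "'o \<Rightarrow> 'o \<Rightarrow> 'o \<Rightarrow> 'm \<Rightarrow> 'm \<Rightarrow> 'o set" where
  "tuple_ideal P \<alpha> \<beta> \<eta> \<epsilon> = lower_ideal P \<alpha> \<eta> \<inter> upper_ideal P \<beta> \<epsilon>"

end

text \<open>
  The value of the trace at \<open>f : \<alpha> \<otimes> V \<rightarrow> \<beta> \<otimes> V\<close> is the scalar given by both formulas, for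
  every choice of \<open>\<tau>\<^sub>V\<close> and of \<open>\<sigma>\<^sub>V\<close>.  The definition is meaningful only where such a scalar
  exists and is unique, which is the case for a trace tuple and \<open>V\<close> in its ideal.
\<close>

definition tuple_trace ::
  "('k, 'r) ring_scheme \<Rightarrow> ('o, 'm, 'k) pivotal_data \<Rightarrow>
   'o \<Rightarrow> 'o \<Rightarrow> 'o \<Rightarrow> 'm \<Rightarrow> 'm \<Rightarrow> 'o \<Rightarrow> 'm \<Rightarrow> 'k" where
  "tuple_trace K C P \<alpha> \<beta> \<eta> \<epsilon> V f =
     (THE c. c \<in> carrier K \<and>
        (\<forall>\<tau>\<in>taus C P \<beta> \<epsilon> V.
           coordinate K (Hom C \<alpha> P) \<eta> (partial_trace C \<alpha> P V (\<tau> \<bullet>\<^bsub>C\<^esub> f)) = c) \<and>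
        (\<forall>\<sigma>\<in>sigmas C P \<alpha> \<eta> V.
           coordinate K (Hom C P \<beta>) \<epsilon> (partial_trace C P \<beta> V (f \<bullet>\<^bsub>C\<^esub> \<sigma>)) = c))"

end

theory Submission
  imports Defs
begin

text \<open>
  Why the theorem holds.  Suppose \<open>\<beta>\<close> is the unit.  A choice of \<open>\<tau>\<close> factors the identity of \<open>V\<close>
  through \<open>P \<otimes> V\<close>, namely as \<open>(\<epsilon> \<otimes> V) \<bullet> \<tau>\<close>.  Insert this factorization into \<open>t'\<^sub>V(f)\<close>.  Cyclicity
  moves \<open>\<epsilon> \<otimes> V\<close> to the other side and the object from \<open>V\<close> to \<open>P \<otimes> V\<close>; the partial trace axiom
  then removes \<open>V\<close>, and what remains is the value of \<open>t'\<^sub>P\<close> at \<open>tr(\<tau> \<bullet> f) \<bullet> (\<alpha> \<otimes> \<epsilon>)\<close>.  But \<open>tr(\<tau> \<bullet> f)\<close>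
  is a morphism \<open>\<alpha> \<rightarrow> P\<close>, so it is \<open>t\<^sub>V(f)\<close> times \<open>\<eta>\<close>, and \<open>\<eta> \<bullet> (\<alpha> \<otimes> \<epsilon>) = \<eta> \<otimes> \<epsilon>\<close>.  This is
  \<open>right_trace_unique_upper_unit\<close>; for \<open>\<alpha>\<close> the unit, the mirrored argument with \<open>\<sigma>\<close> and \<open>\<eta>\<close> is
  \<open>right_trace_unique_lower_unit\<close>.

  Two facts enter.  The first is that \<open>t\<close> is well defined (\<open>partial_traces_agree\<close>).  Its source is
  \<open>trace_tuple_End_scalar\<close>: an endomorphism \<open>x\<close> of \<open>P\<close> is a scalar \<open>c\<close> plus a nilpotent \<open>j\<close>, and over
  a domain a nilpotent acts by zero on a module that is free of rank one, so \<open>x \<bullet> \<eta> = c \<eta>\<close> and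
  \<open>\<epsilon> \<bullet> x = c \<epsilon>\<close> with the same \<open>c\<close>.  Applied to the partial trace of \<open>\<tau> \<bullet> f \<bullet> \<sigma>\<close>, this identifies the
  two formulas for \<open>t\<^sub>V(f)\<close>.

  The second is the normalization, \<open>tuple_trace_eta_eps\<close> and \<open>tuple_trace_eps_eta\<close>.  Here the partial
  trace over \<open>P\<close> is evaluated by sliding \<open>\<epsilon>\<close>, or \<open>\<eta>\<close>, around the loop
  (\<open>partial_trace_slide_effect\<close>, \<open>partial_trace_slide_state\<close>).  For \<open>\<epsilon>\<close> the value is an endomorphism \<open>e\<close>
  of \<open>P\<close> composed with \<open>\<eta>\<close>, where \<open>e = (P \<otimes> \<epsilon>) \<bullet> \<tau>\<close>.  Since \<open>\<epsilon> \<bullet> (P \<otimes> \<epsilon>) = \<epsilon> \<otimes> \<epsilon> = \<epsilon> \<bullet> (\<epsilon> \<otimes> P)\<close>, it satisfies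
  \<open>\<epsilon> \<bullet> e = \<epsilon>\<close>, and hence also \<open>e \<bullet> \<eta> = \<eta>\<close> by the first fact.  The sliding uses that left and right
  duals of a morphism coincide, and that the unit object has dimension one (\<open>dimension_Unit\<close>).
\<close>

section \<open>Calculus in a strict monoidal category\<close>

context monoidal_linear_category
begin

lemmas object_simps = TensO_assoc TensO_Unit_left TensO_Unit_right

lemma whisker_right_Comp:
  assumes "f \<in> mor C W X" "g \<in> mor C V W"
  shows "(f \<bullet> g) \<otimes>\<^sub>m Ident C Y = (f \<otimes>\<^sub>m Ident C Y) \<bullet> (g \<otimes>\<^sub>m Ident C Y)"
  using TensM_Comp[OF assms Ident_mor Ident_mor, of Y] Comp_Ident_left[OF Ident_mor] by simp

lemma whisker_left_Comp:
  assumes "f \<in> mor C W X" "g \<in> mor C V W"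
  shows "Ident C Y \<otimes>\<^sub>m (f \<bullet> g) = (Ident C Y \<otimes>\<^sub>m f) \<bullet> (Ident C Y \<otimes>\<^sub>m g)"
  using TensM_Comp[OF Ident_mor Ident_mor assms, of Y] Comp_Ident_left[OF Ident_mor] by simp

lemma TensM_eq_right_first:
  assumes "f \<in> mor C V W" "g \<in> mor C X Y"
  shows "f \<otimes>\<^sub>m g = (f \<otimes>\<^sub>m Ident C Y) \<bullet> (Ident C V \<otimes>\<^sub>m g)"
  using TensM_Comp[OF assms(1) Ident_mor Ident_mor assms(2)]
    Comp_Ident_left[OF assms(2)] Comp_Ident_right[OF assms(1)] by simp

lemma TensM_eq_left_first:
  assumes "f \<in> mor C V W" "g \<in> mor C X Y"
  shows "f \<otimes>\<^sub>m g = (Ident C W \<otimes>\<^sub>m g) \<bullet> (f \<otimes>\<^sub>m Ident C X)"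
  using TensM_Comp[OF Ident_mor assms(1) assms(2) Ident_mor]
    Comp_Ident_left[OF assms(1)] Comp_Ident_right[OF assms(2)] by simp

lemma interchange:
  assumes "f \<in> mor C V W" "g \<in> mor C X Y"
  shows "(f \<otimes>\<^sub>m Ident C Y) \<bullet> (Ident C V \<otimes>\<^sub>m g) = (Ident C W \<otimes>\<^sub>m g) \<bullet> (f \<otimes>\<^sub>m Ident C X)"
  using TensM_eq_right_first[OF assms] TensM_eq_left_first[OF assms] by simp

text \<open>
  In the next two lemmas one object is the unit, so that the strand carrying it disappears.  Morphisms
  out of the unit are called states and morphisms into it effects.
\<close>

lemma interchange_state:
  assumes "f \<in> mor C V W" "g \<in> mor C \<I> Y"
  shows "(f \<otimes>\<^sub>m Ident C Y) \<bullet> (Ident C V \<otimes>\<^sub>m g) = (Ident C W \<otimes>\<^sub>m g) \<bullet> f"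
  using interchange[OF assms] TensM_Unit_right[OF assms(1)] by simp

lemma interchange_effect:
  assumes "f \<in> mor C V W" "g \<in> mor C X \<I>"
  shows "f \<bullet> (Ident C V \<otimes>\<^sub>m g) = (Ident C W \<otimes>\<^sub>m g) \<bullet> (f \<otimes>\<^sub>m Ident C X)"
  using interchange[OF assms] TensM_Unit_right[OF assms(1)] by simp

lemma TensM_assoc_Ident_right:
  assumes "f \<in> mor C V W"
  shows "(f \<otimes>\<^sub>m Ident C X) \<otimes>\<^sub>m Ident C Y = f \<otimes>\<^sub>m Ident C (X \<otimes>\<^sub>o Y)"
  using TensM_assoc[OF assms Ident_mor Ident_mor] TensM_Ident by simp

lemma TensM_assoc_Ident_left:
  assumes "f \<in> mor C V W"
  shows "Ident C X \<otimes>\<^sub>m (Ident C Y \<otimes>\<^sub>m f) = Ident C (X \<otimes>\<^sub>o Y) \<otimes>\<^sub>m f"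
  using TensM_assoc[OF Ident_mor Ident_mor assms, symmetric] TensM_Ident by simp

lemma whisker_right_mor:
  assumes "f \<in> mor C V W"
  shows "f \<otimes>\<^sub>m Ident C X \<in> mor C (V \<otimes>\<^sub>o X) (W \<otimes>\<^sub>o X)"
  using TensM_mor[OF assms Ident_mor] .

lemma whisker_left_mor:
  assumes "f \<in> mor C V W"
  shows "Ident C X \<otimes>\<^sub>m f \<in> mor C (X \<otimes>\<^sub>o V) (X \<otimes>\<^sub>o W)"
  using TensM_mor[OF Ident_mor assms] .

end


section \<open>The partial trace\<close>

context pivotal_category
begin

lemma cup_mor: "Ident C V \<otimes>\<^sub>m Coev C W \<in> mor C V (V \<otimes>\<^sub>o W \<otimes>\<^sub>o Dual C W)"
  using whisker_left_mor[OF Coev_mor, of V W] by (simp add: object_simps)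

lemma cap_mor: "Ident C V \<otimes>\<^sub>m Ev' C W \<in> mor C (V \<otimes>\<^sub>o W \<otimes>\<^sub>o Dual C W) V"
  using whisker_left_mor[OF Ev'_mor, of V W] by (simp add: object_simps)

lemma strand_mor:
  assumes "g \<in> mor C (V \<otimes>\<^sub>o W) (X \<otimes>\<^sub>o W')"
  shows "g \<otimes>\<^sub>m Ident C Y \<in> mor C (V \<otimes>\<^sub>o W \<otimes>\<^sub>o Y) (X \<otimes>\<^sub>o W' \<otimes>\<^sub>o Y)"
  using whisker_right_mor[OF assms, of Y] by (simp add: object_simps)

lemma partial_trace_mor:
  assumes "g \<in> mor C (V \<otimes>\<^sub>o W) (X \<otimes>\<^sub>o W)"
  shows "partial_trace C V X W g \<in> mor C V X"
  unfolding partial_trace_def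
  by (rule Comp_mor[OF Comp_mor[OF cap_mor strand_mor[OF assms]] cup_mor])

lemma partial_trace_Comp_right:
  assumes g: "g \<in> mor C (V \<otimes>\<^sub>o W) (X \<otimes>\<^sub>o W)" and h: "h \<in> mor C U V"
  shows "partial_trace C U X W (g \<bullet> (h \<otimes>\<^sub>m Ident C W)) = partial_trace C V X W g \<bullet> h"
proof -
  let ?D = "Dual C W"
  have hW: "h \<otimes>\<^sub>m Ident C W \<in> mor C (U \<otimes>\<^sub>o W) (V \<otimes>\<^sub>o W)"
    by (rule whisker_right_mor[OF h])
  have hWD: "h \<otimes>\<^sub>m Ident C (W \<otimes>\<^sub>o ?D) \<in> mor C (U \<otimes>\<^sub>o W \<otimes>\<^sub>o ?D) (V \<otimes>\<^sub>o W \<otimes>\<^sub>o ?D)"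
    by (rule whisker_right_mor[OF h])
  have "(g \<bullet> (h \<otimes>\<^sub>m Ident C W)) \<otimes>\<^sub>m Ident C ?D
      = (g \<otimes>\<^sub>m Ident C ?D) \<bullet> (h \<otimes>\<^sub>m Ident C (W \<otimes>\<^sub>o ?D))"
    using whisker_right_Comp[OF g hW] TensM_assoc_Ident_right[OF h] by simp
  moreover have "(h \<otimes>\<^sub>m Ident C (W \<otimes>\<^sub>o ?D)) \<bullet> (Ident C U \<otimes>\<^sub>m Coev C W)
      = (Ident C V \<otimes>\<^sub>m Coev C W) \<bullet> h"
    by (rule interchange_state[OF h Coev_mor])
  ultimately show ?thesis
    unfolding partial_trace_def
    by (simp add: Comp_assoc[OF cap_mor strand_mor[OF g] hWD, symmetric]
        Comp_assoc[OF Comp_mor[OF cap_mor strand_mor[OF g]] hWD cup_mor]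
        Comp_assoc[OF Comp_mor[OF cap_mor strand_mor[OF g]] cup_mor h])
qed

lemma partial_trace_Comp_left:
  assumes g: "g \<in> mor C (V \<otimes>\<^sub>o W) (X \<otimes>\<^sub>o W)" and h: "h \<in> mor C X Y"
  shows "partial_trace C V Y W ((h \<otimes>\<^sub>m Ident C W) \<bullet> g) = h \<bullet> partial_trace C V X W g"
proof -
  let ?D = "Dual C W"
  have hW: "h \<otimes>\<^sub>m Ident C W \<in> mor C (X \<otimes>\<^sub>o W) (Y \<otimes>\<^sub>o W)"
    by (rule whisker_right_mor[OF h])
  have hWD: "h \<otimes>\<^sub>m Ident C (W \<otimes>\<^sub>o ?D) \<in> mor C (X \<otimes>\<^sub>o W \<otimes>\<^sub>o ?D) (Y \<otimes>\<^sub>o W \<otimes>\<^sub>o ?D)"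
    by (rule whisker_right_mor[OF h])
  have "((h \<otimes>\<^sub>m Ident C W) \<bullet> g) \<otimes>\<^sub>m Ident C ?D
      = (h \<otimes>\<^sub>m Ident C (W \<otimes>\<^sub>o ?D)) \<bullet> (g \<otimes>\<^sub>m Ident C ?D)"
    using whisker_right_Comp[OF hW g] TensM_assoc_Ident_right[OF h] by simp
  moreover have "(Ident C Y \<otimes>\<^sub>m Ev' C W) \<bullet> (h \<otimes>\<^sub>m Ident C (W \<otimes>\<^sub>o ?D))
      = h \<bullet> (Ident C X \<otimes>\<^sub>m Ev' C W)"
    by (rule interchange_effect[OF h Ev'_mor, symmetric])
  ultimately show ?thesis
    unfolding partial_trace_def
    by (simp add: Comp_assoc[OF cap_mor hWD strand_mor[OF g], symmetric]
        Comp_assoc[OF h cap_mor strand_mor[OF g]]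
        Comp_assoc[OF h Comp_mor[OF cap_mor strand_mor[OF g]] cup_mor])
qed


section \<open>The dimension of the unit object\<close>

lemma unit_dual_mor:
  shows "Coev C \<I> \<in> mor C \<I> (Dual C \<I>)" "Ev C \<I> \<in> mor C (Dual C \<I>) \<I>"
    "Coev' C \<I> \<in> mor C \<I> (Dual C \<I>)" "Ev' C \<I> \<in> mor C (Dual C \<I>) \<I>"
  using Coev_mor[of \<I>] Ev_mor[of \<I>] Coev'_mor[of \<I>] Ev'_mor[of \<I>]
  by (simp_all add: object_simps)

lemma Ev_Coev_Unit: "Ev C \<I> \<bullet> Coev C \<I> = Ident C \<I>"
  using zigzag_left(1)[of \<I>]
    TensM_Unit_left[OF unit_dual_mor(2)] TensM_Unit_right[OF unit_dual_mor(1)] by simp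

lemma Coev_Ev_Unit: "Coev C \<I> \<bullet> Ev C \<I> = Ident C (Dual C \<I>)"
  using zigzag_left(2)[of \<I>] interchange_state[OF unit_dual_mor(2,1)]
    TensM_Unit_left[OF unit_dual_mor(1)] by simp

lemma Ev'_Coev'_Unit: "Ev' C \<I> \<bullet> Coev' C \<I> = Ident C \<I>"
  using zigzag_right(1)[of \<I>]
    TensM_Unit_left[OF unit_dual_mor(3)] TensM_Unit_right[OF unit_dual_mor(4)] by simp

lemma TensM_End_Unit:
  assumes "f \<in> mor C V \<I>" "s \<in> mor C \<I> \<I>"
  shows "f \<otimes>\<^sub>m s = s \<bullet> f"
  using TensM_eq_left_first[OF assms] TensM_Unit_left[OF assms(2)] TensM_Unit_right[OF assms(1)]
  by simp

text \<open>
  The zig-zag identities alone leave \<open>s = Ev' \<bullet> Coev\<close> an arbitrary invertible scalar, since \<open>Ev'\<close> and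
  \<open>Coev'\<close> may be rescaled inversely.  The coherence of the two dualities with the tensor product removes
  this freedom: for \<open>V = W = \<I>\<close> it compares an expression with one copy of \<open>Coev\<close> and two of \<open>Ev\<close>
  to one with one copy of \<open>Coev'\<close> and two of \<open>Ev'\<close>, and this forces \<open>s\<close> to be idempotent.
\<close>

lemma dimension_Unit: "Ev' C \<I> \<bullet> Coev C \<I> = Ident C \<I>"
proof -
  let ?D = "Dual C \<I>"
  define a b a' b' s where "a = Coev C \<I>" and "b = Ev C \<I>" and "a' = Coev' C \<I>"
    and "b' = Ev' C \<I>" and "s = b' \<bullet> a"
  note defs = a_def b_def a'_def b'_def s_def
  have m: "a \<in> mor C \<I> ?D" "b \<in> mor C ?D \<I>" "a' \<in> mor C \<I> ?D" "b' \<in> mor C ?D \<I>"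
    using unit_dual_mor by (simp_all add: defs)
  have ba: "b \<bullet> a = Ident C \<I>" and ab: "a \<bullet> b = Ident C ?D" and ba': "b' \<bullet> a' = Ident C \<I>"
    using Ev_Coev_Unit Coev_Ev_Unit Ev'_Coev'_Unit by (simp_all add: defs)
  have s: "s \<in> mor C \<I> \<I>" using Comp_mor[OF m(4,1)] by (simp add: s_def)
  have bb: "b \<otimes>\<^sub>m b \<in> mor C (?D \<otimes>\<^sub>o ?D) \<I>" "b' \<otimes>\<^sub>m b' \<in> mor C (?D \<otimes>\<^sub>o ?D) \<I>"
    and aa: "a \<otimes>\<^sub>m a \<in> mor C \<I> (?D \<otimes>\<^sub>o ?D)"
    using TensM_mor[OF m(2,2)] TensM_mor[OF m(4,4)] TensM_mor[OF m(1,1)]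
    by (simp_all add: object_simps)
  \<comment> \<open>The two canonical morphisms \<open>\<I>\<^sup>* \<otimes> \<I>\<^sup>* \<rightarrow> \<I>\<^sup>*\<close>.\<close>
  have L: "left_dual_tens C \<I> \<I> = a \<bullet> (b \<otimes>\<^sub>m b)"
  proof -
    have "(b \<otimes>\<^sub>m Ident C ?D) \<bullet> (Ident C ?D \<otimes>\<^sub>m b \<otimes>\<^sub>m Ident C ?D) = (b \<otimes>\<^sub>m b) \<otimes>\<^sub>m Ident C ?D"
    proof -
      have "b \<otimes>\<^sub>m b \<otimes>\<^sub>m Ident C ?D 
        = (b \<otimes>\<^sub>m Ident C ?D) \<bullet> (Ident C ?D \<otimes>\<^sub>m b \<otimes>\<^sub>m Ident C ?D)"
        using TensM_eq_right_first[OF m(2) whisker_right_mor[OF m(2), of ?D]]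
        by (simp add: object_simps)
      then show ?thesis using TensM_assoc[OF m(2,2) Ident_mor] by simp
    qed
    then show ?thesis
      using interchange_state[OF bb(1) m(1)] TensM_Unit_left[OF m(1)]
      unfolding left_dual_tens_def by (simp add: object_simps defs)
  qed
  have R: "right_dual_tens C \<I> \<I> = a' \<bullet> (b' \<otimes>\<^sub>m b')"
  proof -
    have "(Ident C ?D \<otimes>\<^sub>m b') \<bullet> (Ident C ?D \<otimes>\<^sub>m b' \<otimes>\<^sub>m Ident C ?D) = Ident C ?D \<otimes>\<^sub>m (b' \<otimes>\<^sub>m b')"
    proof -
      have "b' \<bullet> (b' \<otimes>\<^sub>m Ident C ?D) = b' \<otimes>\<^sub>m b'"
        using TensM_eq_left_first[OF m(4,4)] TensM_Unit_left[OF m(4)] by simp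
      moreover have "b' \<otimes>\<^sub>m Ident C ?D \<in> mor C (?D \<otimes>\<^sub>o ?D) ?D"
        using whisker_right_mor[OF m(4), of ?D] by (simp add: object_simps)
      ultimately show ?thesis using whisker_left_Comp[OF m(4)] by metis
    qed
    then show ?thesis
      using interchange[OF m(3) bb(2)] TensM_Unit_left[OF bb(2)] TensM_Unit_right[OF m(3)]
      unfolding right_dual_tens_def by (simp add: object_simps defs)
  qed
  have *: "(b \<otimes>\<^sub>m b) \<bullet> (a \<otimes>\<^sub>m a) = Ident C \<I>" "(b' \<otimes>\<^sub>m b') \<bullet> (a \<otimes>\<^sub>m a) = s \<bullet> s"
    using TensM_Comp[OF m(2,1,2,1)] TensM_Comp[OF m(4,1,4,1)] ba TensM_Unit_left[OF Ident_mor]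
      TensM_End_Unit[OF s s] by (simp_all add: s_def)
  have "a = (a \<bullet> (b \<otimes>\<^sub>m b)) \<bullet> (a \<otimes>\<^sub>m a)"
    using Comp_assoc[OF m(1) bb(1) aa] * Comp_Ident_right[OF m(1)] by simp
  also have "\<dots> = (a' \<bullet> (b' \<otimes>\<^sub>m b')) \<bullet> (a \<otimes>\<^sub>m a)"
    using L R dual_tens_coincide by simp
  also have "\<dots> = a' \<bullet> (s \<bullet> s)"
    using Comp_assoc[OF m(3) bb(2) aa] * by simp
  finally have a: "a = a' \<bullet> (s \<bullet> s)" .
  have "s = b' \<bullet> (a' \<bullet> (s \<bullet> s))" using a by (simp add: s_def)
  then have ss: "s = s \<bullet> s"
    using Comp_assoc[OF m(4,3) Comp_mor[OF s s]] ba' Comp_Ident_left[OF Comp_mor[OF s s]] by simp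
  define r where "r = b \<bullet> a'"
  have r: "r \<in> mor C \<I> \<I>" using Comp_mor[OF m(2,3)] by (simp add: r_def)
  \<comment> \<open>\<open>r\<close> inverts \<open>s\<close>, and an invertible idempotent is an identity.\<close>
  have "a \<bullet> r = a'"
    using Comp_assoc[OF m(1,2,3)] ab Comp_Ident_left[OF m(3)] by (simp add: r_def)
  then have sr: "s \<bullet> r = Ident C \<I>"
    using Comp_assoc[OF m(4,1) r] ba' by (simp add: s_def)
  have "s = s \<bullet> (s \<bullet> r)" using sr Comp_Ident_right[OF s] by simp
  also have "\<dots> = (s \<bullet> s) \<bullet> r" by (rule Comp_assoc[OF s s r, symmetric])
  also have "\<dots> = Ident C \<I>" using ss sr by simp
  finally show ?thesis by (simp add: defs)
qed


section \<open>Sliding states and effects around a loop\<close>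

text \<open>
  The left dual of \<open>\<epsilon>\<close> is the left-hand side after \<open>Ev\<close> of the unit, the right dual is the right-hand
  side after \<open>Ev'\<close> of the unit.  The two duals coincide, and composing with \<open>Coev\<close> of the unit cancels
  both factors, the second one because the unit has dimension one.
\<close>

lemma bend_effect:
  assumes e: "\<epsilon> \<in> mor C P \<I>"
  shows "(\<epsilon> \<otimes>\<^sub>m Ident C (Dual C P)) \<bullet> Coev C P = (Ident C (Dual C P) \<otimes>\<^sub>m \<epsilon>) \<bullet> Coev' C P"
    (is "?x = ?x'")
proof -
  let ?D = "Dual C \<I>" and ?Q = "Dual C P"
  have ex: "\<epsilon> \<otimes>\<^sub>m Ident C ?Q \<in> mor C (P \<otimes>\<^sub>o ?Q) ?Q" "Ident C ?Q \<otimes>\<^sub>m \<epsilon> \<in> mor C (?Q \<otimes>\<^sub>o P) ?Q"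
    using whisker_right_mor[OF e, of ?Q] whisker_left_mor[OF e, of ?Q] 
    by (simp_all add: object_simps)
  have x: "?x \<in> mor C \<I> ?Q" "?x' \<in> mor C \<I> ?Q"
    using Comp_mor[OF ex(1) Coev_mor] Comp_mor[OF ex(2) Coev'_mor] by simp_all
  have "left_dual C P \<I> \<epsilon> = (Ev C \<I> \<otimes>\<^sub>m Ident C ?Q) \<bullet> (Ident C ?D \<otimes>\<^sub>m ?x)"
    using Comp_assoc[OF whisker_right_mor[OF unit_dual_mor(2)] whisker_left_mor[OF ex(1)]
        whisker_left_mor[OF Coev_mor]] whisker_left_Comp[OF ex(1) Coev_mor]
    by (simp add: left_dual_def object_simps)
  then have L: "left_dual C P \<I> \<epsilon> = ?x \<bullet> Ev C \<I>"
    using interchange_state[OF unit_dual_mor(2) x(1)] TensM_Unit_left[OF x(1)] by simp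
  have "right_dual C P \<I> \<epsilon> = (Ident C ?Q \<otimes>\<^sub>m Ev' C \<I>) \<bullet> (?x' \<otimes>\<^sub>m Ident C ?D)"
    using Comp_assoc[OF whisker_left_mor[OF unit_dual_mor(4)] whisker_right_mor[OF ex(2)]
        whisker_right_mor[OF Coev'_mor]] whisker_right_Comp[OF ex(2) Coev'_mor]
      TensM_assoc[OF Ident_mor e Ident_mor]
    by (simp add: right_dual_def object_simps)
  then have R: "right_dual C P \<I> \<epsilon> = ?x' \<bullet> Ev' C \<I>"
    using interchange_effect[OF x(2) unit_dual_mor(4)] TensM_Unit_left[OF unit_dual_mor(4)] by simp
  have "?x = (?x \<bullet> Ev C \<I>) \<bullet> Coev C \<I>"
    using Comp_assoc[OF x(1) unit_dual_mor(2,1)] Ev_Coev_Unit Comp_Ident_right[OF x(1)] by simp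
  also have "\<dots> = (?x' \<bullet> Ev' C \<I>) \<bullet> Coev C \<I>"
    using L R duals_coincide[OF e] by simp
  also have "\<dots> = ?x'"
    using Comp_assoc[OF x(2) unit_dual_mor(4,1)] dimension_Unit Comp_Ident_right[OF x(2)] by simp
  finally show ?thesis .
qed

text \<open>
  The mirror image of \<open>bend_effect\<close>: both duals of \<open>\<eta>\<close> end in the dual of the unit, and composing
  with \<open>Ev'\<close> of the unit on the left cancels the extra factors.
\<close>

lemma bend_state:
  assumes e: "\<eta> \<in> mor C \<I> P"
  shows "Ev' C P \<bullet> (\<eta> \<otimes>\<^sub>m Ident C (Dual C P)) = Ev C P \<bullet> (Ident C (Dual C P) \<otimes>\<^sub>m \<eta>)"
    (is "?y' = ?y")
proof -
  let ?D = "Dual C \<I>" and ?Q = "Dual C P"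
  have ey: "\<eta> \<otimes>\<^sub>m Ident C ?Q \<in> mor C ?Q (P \<otimes>\<^sub>o ?Q)" "Ident C ?Q \<otimes>\<^sub>m \<eta> \<in> mor C ?Q (?Q \<otimes>\<^sub>o P)"
    using whisker_right_mor[OF e, of ?Q] whisker_left_mor[OF e, of ?Q] 
    by (simp_all add: object_simps)
  have y: "?y' \<in> mor C ?Q \<I>" "?y \<in> mor C ?Q \<I>"
    using Comp_mor[OF Ev'_mor ey(1)] Comp_mor[OF Ev_mor ey(2)] by simp_all
  have "left_dual C \<I> P \<eta> = (?y \<otimes>\<^sub>m Ident C ?D) \<bullet> (Ident C ?Q \<otimes>\<^sub>m Coev C \<I>)"
    using whisker_right_Comp[OF Ev_mor ey(2)] TensM_assoc[OF Ident_mor e Ident_mor]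
    by (simp add: left_dual_def object_simps)
  then have L: "left_dual C \<I> P \<eta> = Coev C \<I> \<bullet> ?y"
    using interchange_state[OF y(2) unit_dual_mor(1)] TensM_Unit_left[OF unit_dual_mor(1)] by simp
  have "right_dual C \<I> P \<eta> = (Ident C ?D \<otimes>\<^sub>m ?y') \<bullet> (Coev' C \<I> \<otimes>\<^sub>m Ident C ?Q)"
    using whisker_left_Comp[OF Ev'_mor ey(1)]
    by (simp add: right_dual_def object_simps)
  then have R: "right_dual C \<I> P \<eta> = Coev' C \<I> \<bullet> ?y'"
    using interchange_effect[OF unit_dual_mor(3) y(1)] TensM_Unit_left[OF y(1)] by simp
  have "?y' = Ev' C \<I> \<bullet> (Coev' C \<I> \<bullet> ?y')"
    using Comp_assoc[OF unit_dual_mor(4,3) y(1)] Ev'_Coev'_Unit Comp_Ident_left[OF y(1)] by simp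
  also have "\<dots> = Ev' C \<I> \<bullet> (Coev C \<I> \<bullet> ?y)"
    using L R duals_coincide[OF e] by simp
  also have "\<dots> = ?y"
    using Comp_assoc[OF unit_dual_mor(4,1) y(2)] dimension_Unit Comp_Ident_left[OF y(2)] by simp
  finally show ?thesis .
qed

text \<open>
  Cyclicity of the partial trace in the traced strand, for an effect.  Bent to the dual strand, \<open>\<epsilon>\<close>
  becomes a state \<open>x\<close>; by \<open>bend_effect\<close>, \<open>x\<close> can equally be read as \<open>\<epsilon>\<close> bent through the right duality,
  and the right zig-zag straightens it again on the other side of \<open>h\<close>.
\<close>

lemma partial_trace_slide_effect:
  assumes h: "h \<in> mor C V (X \<otimes>\<^sub>o P)" and e: "\<epsilon> \<in> mor C P \<I>"
  shows "partial_trace C V X P (h \<bullet> (Ident C V \<otimes>\<^sub>m \<epsilon>)) = (Ident C X \<otimes>\<^sub>m \<epsilon>) \<bullet> h"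
proof -
  let ?Q = "Dual C P"
  define x where "x = (\<epsilon> \<otimes>\<^sub>m Ident C ?Q) \<bullet> Coev C P"
  have eQ: "\<epsilon> \<otimes>\<^sub>m Ident C ?Q \<in> mor C (P \<otimes>\<^sub>o ?Q) ?Q" 
    and Qe: "Ident C ?Q \<otimes>\<^sub>m \<epsilon> \<in> mor C (?Q \<otimes>\<^sub>o P) ?Q"
    using whisker_right_mor[OF e, of ?Q] whisker_left_mor[OF e, of ?Q] 
    by (simp_all add: object_simps)
  have x: "x \<in> mor C \<I> ?Q" using Comp_mor[OF eQ Coev_mor] by (simp add: x_def)
  have Px: "Ident C P \<otimes>\<^sub>m x \<in> mor C P (P \<otimes>\<^sub>o ?Q)"
    using whisker_left_mor[OF x, of P] by (simp add: object_simps)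
  have Ve: "Ident C V \<otimes>\<^sub>m \<epsilon> \<in> mor C (V \<otimes>\<^sub>o P) V"
    using whisker_left_mor[OF e, of V] by (simp add: object_simps)
  have hQ: "h \<otimes>\<^sub>m Ident C ?Q \<in> mor C (V \<otimes>\<^sub>o ?Q) (X \<otimes>\<^sub>o P \<otimes>\<^sub>o ?Q)"
    using whisker_right_mor[OF h, of ?Q] by (simp add: object_simps)
  have VeQ: "Ident C V \<otimes>\<^sub>m \<epsilon> \<otimes>\<^sub>m Ident C ?Q \<in> mor C (V \<otimes>\<^sub>o P \<otimes>\<^sub>o ?Q) (V \<otimes>\<^sub>o ?Q)"
    by (rule whisker_left_mor[OF eQ])
  have XPx: "Ident C X \<otimes>\<^sub>m Ident C P \<otimes>\<^sub>m x \<in> mor C (X \<otimes>\<^sub>o P) (X \<otimes>\<^sub>o P \<otimes>\<^sub>o ?Q)"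
    by (rule whisker_left_mor[OF Px])
  have straighten: "Ev' C P \<bullet> (Ident C P \<otimes>\<^sub>m x) = \<epsilon>"
  proof -
    have PC: "Ident C P \<otimes>\<^sub>m Coev' C P \<in> mor C P (P \<otimes>\<^sub>o ?Q \<otimes>\<^sub>o P)"
      using whisker_left_mor[OF Coev'_mor, of P P] by (simp add: object_simps)
    have EP: "Ev' C P \<otimes>\<^sub>m Ident C P \<in> mor C (P \<otimes>\<^sub>o ?Q \<otimes>\<^sub>o P) P"
      using whisker_right_mor[OF Ev'_mor, of P P] by (simp add: object_simps)
    have "Ident C P \<otimes>\<^sub>m x = (Ident C P \<otimes>\<^sub>m (Ident C ?Q \<otimes>\<^sub>m \<epsilon>)) \<bullet> (Ident C P \<otimes>\<^sub>m Coev' C P)"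
      using whisker_left_Comp[OF Qe Coev'_mor] bend_effect[OF e] by (simp add: x_def)
    then have "Ev' C P \<bullet> (Ident C P \<otimes>\<^sub>m x)
        = (Ev' C P \<bullet> (Ident C (P \<otimes>\<^sub>o ?Q) \<otimes>\<^sub>m \<epsilon>)) \<bullet> (Ident C P \<otimes>\<^sub>m Coev' C P)"
      using Comp_assoc[OF Ev'_mor whisker_left_mor[OF Qe] PC] TensM_assoc_Ident_left[OF e] by simp
    also have "\<dots> = (\<epsilon> \<bullet> (Ev' C P \<otimes>\<^sub>m Ident C P)) \<bullet> (Ident C P \<otimes>\<^sub>m Coev' C P)"
      using interchange_effect[OF Ev'_mor e] TensM_Unit_left[OF e] by simp
    also have "\<dots> = \<epsilon>"
      using Comp_assoc[OF e EP PC] zigzag_right(1) Comp_Ident_right[OF e] by simp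
    finally show ?thesis .
  qed
  have "partial_trace C V X P (h \<bullet> (Ident C V \<otimes>\<^sub>m \<epsilon>))
      = ((Ident C X \<otimes>\<^sub>m Ev' C P) \<bullet> ((h \<otimes>\<^sub>m Ident C ?Q) \<bullet> (Ident C V \<otimes>\<^sub>m \<epsilon> \<otimes>\<^sub>m Ident C ?Q)))
         \<bullet> (Ident C V \<otimes>\<^sub>m Coev C P)"
    using whisker_right_Comp[OF h Ve] TensM_assoc[OF Ident_mor e Ident_mor]
    by (simp add: partial_trace_def)
  also have "\<dots> = (Ident C X \<otimes>\<^sub>m Ev' C P) \<bullet> ((h \<otimes>\<^sub>m Ident C ?Q) \<bullet> (Ident C V \<otimes>\<^sub>m x))"
    using Comp_assoc[OF cap_mor Comp_mor[OF hQ VeQ] cup_mor] Comp_assoc[OF hQ VeQ cup_mor]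
      whisker_left_Comp[OF eQ Coev_mor] by (simp add: x_def)
  also have "\<dots> = (Ident C X \<otimes>\<^sub>m Ev' C P) \<bullet> ((Ident C X \<otimes>\<^sub>m Ident C P \<otimes>\<^sub>m x) \<bullet> h)"
    using interchange_state[OF h x] TensM_assoc_Ident_left[OF x] by simp
  also have "\<dots> = (Ident C X \<otimes>\<^sub>m \<epsilon>) \<bullet> h"
    using Comp_assoc[OF cap_mor XPx h] whisker_left_Comp[OF Ev'_mor Px] straighten by simp
  finally show ?thesis .
qed

text \<open>
  The same for a state, which becomes an effect \<open>y\<close> on the dual strand; here \<open>bend_state\<close> and the left
  zig-zag straighten it.
\<close>

lemma partial_trace_slide_state:
  assumes h: "h \<in> mor C (V \<otimes>\<^sub>o P) X" and e: "\<eta> \<in> mor C \<I> P"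
  shows "partial_trace C V X P ((Ident C X \<otimes>\<^sub>m \<eta>) \<bullet> h) = h \<bullet> (Ident C V \<otimes>\<^sub>m \<eta>)"
proof -
  let ?Q = "Dual C P"
  define y where "y = Ev' C P \<bullet> (\<eta> \<otimes>\<^sub>m Ident C ?Q)"
  have eQ: "\<eta> \<otimes>\<^sub>m Ident C ?Q \<in> mor C ?Q (P \<otimes>\<^sub>o ?Q)" 
    and Qe: "Ident C ?Q \<otimes>\<^sub>m \<eta> \<in> mor C ?Q (?Q \<otimes>\<^sub>o P)"
    using whisker_right_mor[OF e, of ?Q] whisker_left_mor[OF e, of ?Q] 
    by (simp_all add: object_simps)
  have y: "y \<in> mor C ?Q \<I>" using Comp_mor[OF Ev'_mor eQ] by (simp add: y_def)
  have Py: "Ident C P \<otimes>\<^sub>m y \<in> mor C (P \<otimes>\<^sub>o ?Q) P"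
    using whisker_left_mor[OF y, of P] by (simp add: object_simps)
  have Xy: "Ident C X \<otimes>\<^sub>m y \<in> mor C (X \<otimes>\<^sub>o ?Q) X"
    using whisker_left_mor[OF y, of X] by (simp add: object_simps)
  have Xe: "Ident C X \<otimes>\<^sub>m \<eta> \<in> mor C X (X \<otimes>\<^sub>o P)"
    using whisker_left_mor[OF e, of X] by (simp add: object_simps)
  have hQ: "h \<otimes>\<^sub>m Ident C ?Q \<in> mor C (V \<otimes>\<^sub>o P \<otimes>\<^sub>o ?Q) (X \<otimes>\<^sub>o ?Q)"
    using whisker_right_mor[OF h, of ?Q] by (simp add: object_simps)
  have XeQ: "Ident C X \<otimes>\<^sub>m \<eta> \<otimes>\<^sub>m Ident C ?Q \<in> mor C (X \<otimes>\<^sub>o ?Q) (X \<otimes>\<^sub>o P \<otimes>\<^sub>o ?Q)"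
    by (rule whisker_left_mor[OF eQ])
  have VPy: "Ident C V \<otimes>\<^sub>m Ident C P \<otimes>\<^sub>m y \<in> mor C (V \<otimes>\<^sub>o P \<otimes>\<^sub>o ?Q) (V \<otimes>\<^sub>o P)"
    by (rule whisker_left_mor[OF Py])
  have straighten: "(Ident C P \<otimes>\<^sub>m y) \<bullet> Coev C P = \<eta>"
  proof -
    have PE: "Ident C P \<otimes>\<^sub>m Ev C P \<in> mor C (P \<otimes>\<^sub>o ?Q \<otimes>\<^sub>o P) P"
      using whisker_left_mor[OF Ev_mor, of P P] by (simp add: object_simps)
    have CP: "Coev C P \<otimes>\<^sub>m Ident C P \<in> mor C P (P \<otimes>\<^sub>o ?Q \<otimes>\<^sub>o P)"
      using whisker_right_mor[OF Coev_mor, of P P] by (simp add: object_simps)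
    have "Ident C P \<otimes>\<^sub>m y = (Ident C P \<otimes>\<^sub>m Ev C P) \<bullet> (Ident C P \<otimes>\<^sub>m (Ident C ?Q \<otimes>\<^sub>m \<eta>))"
      using whisker_left_Comp[OF Ev_mor Qe] bend_state[OF e] by (simp add: y_def)
    then have "(Ident C P \<otimes>\<^sub>m y) \<bullet> Coev C P
        = (Ident C P \<otimes>\<^sub>m Ev C P) \<bullet> ((Ident C (P \<otimes>\<^sub>o ?Q) \<otimes>\<^sub>m \<eta>) \<bullet> Coev C P)"
      using Comp_assoc[OF PE whisker_left_mor[OF Qe] Coev_mor] TensM_assoc_Ident_left[OF e] by simp
    also have "\<dots> = (Ident C P \<otimes>\<^sub>m Ev C P) \<bullet> ((Coev C P \<otimes>\<^sub>m Ident C P) \<bullet> \<eta>)"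
      using interchange_state[OF Coev_mor e] TensM_Unit_left[OF e] by metis
    also have "\<dots> = \<eta>"
      using Comp_assoc[OF PE CP e] zigzag_left(1) Comp_Ident_left[OF e] by simp
    finally show ?thesis .
  qed
  have "partial_trace C V X P ((Ident C X \<otimes>\<^sub>m \<eta>) \<bullet> h)
      = ((Ident C X \<otimes>\<^sub>m Ev' C P) \<bullet> ((Ident C X \<otimes>\<^sub>m \<eta> \<otimes>\<^sub>m Ident C ?Q) \<bullet> (h \<otimes>\<^sub>m Ident C ?Q)))
         \<bullet> (Ident C V \<otimes>\<^sub>m Coev C P)"
    using whisker_right_Comp[OF Xe h] TensM_assoc[OF Ident_mor e Ident_mor]
    by (simp add: partial_trace_def)
  also have "\<dots> = ((Ident C X \<otimes>\<^sub>m y) \<bullet> (h \<otimes>\<^sub>m Ident C ?Q)) \<bullet> (Ident C V \<otimes>\<^sub>m Coev C P)"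
    using Comp_assoc[OF cap_mor XeQ hQ] whisker_left_Comp[OF Ev'_mor eQ] by (simp add: y_def)
  also have "\<dots> = (h \<bullet> (Ident C V \<otimes>\<^sub>m Ident C P \<otimes>\<^sub>m y)) \<bullet> (Ident C V \<otimes>\<^sub>m Coev C P)"
    using interchange_effect[OF h y] TensM_assoc_Ident_left[OF y] by simp
  also have "\<dots> = h \<bullet> (Ident C V \<otimes>\<^sub>m \<eta>)"
    using Comp_assoc[OF h VPy cup_mor] whisker_left_Comp[OF Py Coev_mor] straighten by simp
  finally show ?thesis .
qed

end

section \<open>Endomorphisms of an absolutely indecomposable object\<close>

lemma zero_in_jacobson_radical:
  assumes "\<zero>\<^bsub>R\<^esub> \<in> carrier R"
  shows "\<zero>\<^bsub>R\<^esub> \<in> jacobson_radical R"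
proof -
  have "\<zero>\<^bsub>R\<^esub> \<in> I" if "maximal_left_ideal R I" for I
  proof -
    from that have "additive_subgroup I R"
      by (simp add: maximal_left_ideal_def left_ideal_def)
    then show ?thesis by (rule additive_subgroup.zero_closed)
  qed
  with assms show ?thesis by (simp add: jacobson_radical_def)
qed

lemma freely_generated_by_smult_inject:
  assumes "freely_generated_by K M x" "a \<odot>\<^bsub>M\<^esub> x = b \<odot>\<^bsub>M\<^esub> x"
    and "a \<in> carrier K" "b \<in> carrier K" "a \<odot>\<^bsub>M\<^esub> x \<in> carrier M"
  shows "a = b"
  using assms unfolding freely_generated_by_def by metis

lemma coordinate_smult:
  assumes "freely_generated_by K M x" "c \<in> carrier K" "c \<odot>\<^bsub>M\<^esub> x \<in> carrier M"
  shows "coordinate K M x (c \<odot>\<^bsub>M\<^esub> x) = c"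
  unfolding coordinate_def
  by (rule the_equality) (use assms freely_generated_by_smult_inject[OF assms(1)] in auto)

lemma (in domain) nat_pow_eq_zeroD:
  fixes n :: nat
  assumes "d \<in> carrier R" "d [^] n = \<zero>"
  shows "d = \<zero>"
  using assms by (induction n) (auto simp: integral_iff)

context linear_category
begin

text \<open>
  If \<open>c\<close> is the scalar corresponding to the class of \<open>x\<close>, then \<open>c\<close> times the identity has the same
  class, because the isomorphism of the quotient with the ground ring is one of algebras.
\<close>

lemma absolutely_indecomposable_decomposition:
  assumes ai: "absolutely_indecomposable K C P" and x: "x \<in> mor C P P"
  obtains c j where "c \<in> carrier K" "j \<in> jacobson_radical (End_ring C P)"
    "x = j \<oplus>\<^bsub>Hom C P P\<^esub> (c \<odot>\<^bsub>Hom C P P\<^esub> Ident C P)"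
proof -
  interpret M: module K "Hom C P P" by (rule Hom_module)
  let ?E = "End_ring C P"
  define J where "J = jacobson_radical ?E"
  have E: "carrier ?E = mor C P P" "\<one>\<^bsub>?E\<^esub> = Ident C P" "\<zero>\<^bsub>?E\<^esub> = \<zero>\<^bsub>Hom C P P\<^esub>"
    "add ?E = add (Hom C P P)" "smult ?E = smult (Hom C P P)"
    by (simp_all add: End_ring_def)
  obtain \<phi> where \<phi>: "\<phi> \<in> ring_iso (?E Quot J) K"
    and \<phi>_smult: "\<And>c x. c \<in> carrier K \<Longrightarrow> x \<in> carrier ?E \<Longrightarrow>
        \<phi> (J +>\<^bsub>?E\<^esub> (c \<odot>\<^bsub>?E\<^esub> x)) = c \<otimes>\<^bsub>K\<^esub> \<phi> (J +>\<^bsub>?E\<^esub> x)"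
    using ai unfolding absolutely_indecomposable_def J_def Let_def by blast
  have coset: "J +>\<^bsub>?E\<^esub> y \<in> carrier (?E Quot J)" if "y \<in> mor C P P" for y
    using that E(1) by (auto simp: FactRing_def A_RCOSETS_def' a_r_coset_def')
  define c where "c = \<phi> (J +>\<^bsub>?E\<^esub> x)"
  have c: "c \<in> carrier K"
    using ring_iso_memE(1)[OF \<phi> coset[OF x]] by (simp add: c_def)
  have "\<phi> (J +>\<^bsub>?E\<^esub> Ident C P) = \<one>\<^bsub>K\<^esub>"
    using ring_iso_memE(4)[OF \<phi>] by (simp add: FactRing_def E)
  then have "\<phi> (J +>\<^bsub>?E\<^esub> (c \<odot>\<^bsub>Hom C P P\<^esub> Ident C P)) = \<phi> (J +>\<^bsub>?E\<^esub> x)"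
    using \<phi>_smult[of c "Ident C P"] c Ident_mor[of P] by (simp add: E c_def)
  then have eq: "J +>\<^bsub>?E\<^esub> x = J +>\<^bsub>?E\<^esub> (c \<odot>\<^bsub>Hom C P P\<^esub> Ident C P)"
    using ring_iso_memE(5)[OF \<phi>] coset[OF x] coset[OF M.smult_closed[OF c Ident_mor]]
    unfolding bij_betw_def inj_on_def by metis
  have "\<zero>\<^bsub>?E\<^esub> \<in> J"
    unfolding J_def by (rule zero_in_jacobson_radical) (simp add: E)
  then have "x \<in> J +>\<^bsub>?E\<^esub> x"
    using M.l_zero[OF x] unfolding a_r_coset_def' E by force
  then obtain j where "j \<in> J" "x = j \<oplus>\<^bsub>Hom C P P\<^esub> (c \<odot>\<^bsub>Hom C P P\<^esub> Ident C P)"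
    unfolding eq unfolding a_r_coset_def' E by blast
  with c show thesis by (auto simp: J_def intro: that)
qed

lemma end_nilpotent_power:
  assumes "end_nilpotent C P" "j \<in> jacobson_radical (End_ring C P)"
  obtains n where "((\<bullet>) j ^^ n) (Ident C P) = \<zero>\<^bsub>Hom C P P\<^esub>"
proof -
  let ?E = "End_ring C P" and ?J = "jacobson_radical (End_ring C P)"
  obtain n where n: "(ideal_prod ?E ?J ^^ n) (carrier ?E) = {\<zero>\<^bsub>?E\<^esub>}"
    using assms(1) unfolding end_nilpotent_def nilpotent_ideal_def by blast
  have "((\<bullet>) j ^^ n) (Ident C P) \<in> (ideal_prod ?E ?J ^^ n) (carrier ?E)" for n
  proof (induction n)
    case 0
    then show ?case using Ident_mor by (simp add: End_ring_def)
  next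
    case (Suc n)
    then show ?case using ideal_prod.prod[OF assms(2) Suc, where R = ?E] by (simp add: End_ring_def)
  qed
  then have "((\<bullet>) j ^^ n) (Ident C P) = \<zero>\<^bsub>?E\<^esub>" using n by blast
  then show thesis using that by (simp add: End_ring_def)
qed

lemma Comp_zero_left:
  assumes g: "g \<in> mor C V W"
  shows "\<zero>\<^bsub>Hom C W X\<^esub> \<bullet> g = \<zero>\<^bsub>Hom C V X\<^esub>"
proof -
  interpret M: module K "Hom C W X" by (rule Hom_module)
  interpret N: module K "Hom C V X" by (rule Hom_module)
  show ?thesis
    using Comp_smult_left[OF M.R.zero_closed M.M.zero_closed g] Comp_mor[OF M.M.zero_closed g]
      M.smult_l_null[OF M.M.zero_closed] N.smult_l_null by metis
qed

lemma Comp_zero_right: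
  assumes f: "f \<in> mor C W X"
  shows "f \<bullet> \<zero>\<^bsub>Hom C V W\<^esub> = \<zero>\<^bsub>Hom C V X\<^esub>"
proof -
  interpret M: module K "Hom C V W" by (rule Hom_module)
  interpret N: module K "Hom C V X" by (rule Hom_module)
  show ?thesis
    using Comp_smult_right[OF M.R.zero_closed f M.M.zero_closed] Comp_mor[OF f M.M.zero_closed]
      M.smult_l_null[OF M.M.zero_closed] N.smult_l_null by metis
qed

lemma Comp_power_mor:
  assumes "j \<in> mor C P P"
  shows "((\<bullet>) j ^^ n) (Ident C P) \<in> mor C P P"
  using assms by (induction n) (auto intro: Comp_mor Ident_mor)

text \<open>
  As \<open>\<eta>\<close> generates, \<open>j \<bullet> \<eta> = d \<eta>\<close> for some scalar \<open>d\<close>, so the power of \<open>j\<close> that vanishes makes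
  \<open>d\<^sup>n \<eta> = 0\<close>.  Freeness gives \<open>d\<^sup>n = 0\<close>, and a domain has no nonzero nilpotents.
\<close>

lemma nilpotent_kills_generator_right:
  assumes K: "domain K" and j: "j \<in> mor C P P"
    and nil: "((\<bullet>) j ^^ n) (Ident C P) = \<zero>\<^bsub>Hom C P P\<^esub>"
    and \<eta>: "freely_generated_by K (Hom C \<alpha> P) \<eta>"
  shows "j \<bullet> \<eta> = \<zero>\<^bsub>Hom C \<alpha> P\<^esub>"
proof -
  interpret K: domain K by (rule K)
  interpret M: module K "Hom C \<alpha> P" by (rule Hom_module)
  have e: "\<eta> \<in> mor C \<alpha> P" using \<eta> by (simp add: freely_generated_by_def)
  obtain d where d: "d \<in> carrier K" "j \<bullet> \<eta> = d \<odot>\<^bsub>Hom C \<alpha> P\<^esub> \<eta>"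
    using \<eta> Comp_mor[OF j e] unfolding freely_generated_by_def by blast
  have pow: "((\<bullet>) j ^^ n) (Ident C P) \<bullet> \<eta> = (d [^]\<^bsub>K\<^esub> n) \<odot>\<^bsub>Hom C \<alpha> P\<^esub> \<eta>" for n :: nat
  proof (induction n)
    case 0
    then show ?case using e Comp_Ident_left[OF e] by simp
  next
    case (Suc n)
    have "((\<bullet>) j ^^ Suc n) (Ident C P) \<bullet> \<eta> = j \<bullet> ((d [^]\<^bsub>K\<^esub> n) \<odot>\<^bsub>Hom C \<alpha> P\<^esub> \<eta>)"
      using Comp_assoc[OF j Comp_power_mor[OF j] e] Suc by simp
    also have "\<dots> = (d [^]\<^bsub>K\<^esub> n) \<odot>\<^bsub>Hom C \<alpha> P\<^esub> (d \<odot>\<^bsub>Hom C \<alpha> P\<^esub> \<eta>)"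
      using Comp_smult_right[OF _ j e] d by simp
    also have "\<dots> = (d [^]\<^bsub>K\<^esub> Suc n) \<odot>\<^bsub>Hom C \<alpha> P\<^esub> \<eta>"
      using d e by (simp add: M.smult_assoc1)
    finally show ?case .
  qed
  have "(d [^]\<^bsub>K\<^esub> n) \<odot>\<^bsub>Hom C \<alpha> P\<^esub> \<eta> = \<zero>\<^bsub>K\<^esub> \<odot>\<^bsub>Hom C \<alpha> P\<^esub> \<eta>"
    using pow[of n] nil Comp_zero_left[OF e] M.smult_l_null[OF e] by simp
  then have "d [^]\<^bsub>K\<^esub> n = \<zero>\<^bsub>K\<^esub>"
    by (rule freely_generated_by_smult_inject[OF \<eta>]) (use d e in auto)
  then have "d = \<zero>\<^bsub>K\<^esub>" by (rule K.nat_pow_eq_zeroD[OF d(1)])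
  then show ?thesis using d(2) M.smult_l_null[OF e] by simp
qed

lemma nilpotent_kills_generator_left:
  assumes K: "domain K" and j: "j \<in> mor C P P"
    and nil: "((\<bullet>) j ^^ n) (Ident C P) = \<zero>\<^bsub>Hom C P P\<^esub>"
    and \<epsilon>: "freely_generated_by K (Hom C P \<beta>) \<epsilon>"
  shows "\<epsilon> \<bullet> j = \<zero>\<^bsub>Hom C P \<beta>\<^esub>"
proof -
  interpret K: domain K by (rule K)
  interpret M: module K "Hom C P \<beta>" by (rule Hom_module)
  have e: "\<epsilon> \<in> mor C P \<beta>" using \<epsilon> by (simp add: freely_generated_by_def)
  obtain d where d: "d \<in> carrier K" "\<epsilon> \<bullet> j = d \<odot>\<^bsub>Hom C P \<beta>\<^esub> \<epsilon>"
    using \<epsilon> Comp_mor[OF e j] unfolding freely_generated_by_def by blast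
  have pow: "\<epsilon> \<bullet> ((\<bullet>) j ^^ n) (Ident C P) = (d [^]\<^bsub>K\<^esub> n) \<odot>\<^bsub>Hom C P \<beta>\<^esub> \<epsilon>" for n :: nat
  proof (induction n)
    case 0
    then show ?case using e Comp_Ident_right[OF e] by simp
  next
    case (Suc n)
    have "\<epsilon> \<bullet> ((\<bullet>) j ^^ Suc n) (Ident C P) = d \<odot>\<^bsub>Hom C P \<beta>\<^esub> (\<epsilon> \<bullet> ((\<bullet>) j ^^ n) (Ident C P))"
      using Comp_assoc[OF e j Comp_power_mor[OF j], symmetric] d
        Comp_smult_left[OF d(1) e Comp_power_mor[OF j]] by simp
    also have "\<dots> = (d [^]\<^bsub>K\<^esub> Suc n) \<odot>\<^bsub>Hom C P \<beta>\<^esub> \<epsilon>"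
      using d e Suc by (simp add: M.smult_assoc1[symmetric] K.m_comm)
    finally show ?case .
  qed
  have "(d [^]\<^bsub>K\<^esub> n) \<odot>\<^bsub>Hom C P \<beta>\<^esub> \<epsilon> = \<zero>\<^bsub>K\<^esub> \<odot>\<^bsub>Hom C P \<beta>\<^esub> \<epsilon>"
    using pow[of n] nil Comp_zero_right[OF e] M.smult_l_null[OF e] by simp
  then have "d [^]\<^bsub>K\<^esub> n = \<zero>\<^bsub>K\<^esub>"
    by (rule freely_generated_by_smult_inject[OF \<epsilon>]) (use d e in auto)
  then have "d = \<zero>\<^bsub>K\<^esub>" by (rule K.nat_pow_eq_zeroD[OF d(1)])
  then show ?thesis using d(2) M.smult_l_null[OF e] by simp
qed

text \<open>
  The common \<open>c\<close> is the point: it links the coordinate with respect to \<open>\<eta>\<close> to the one with respect to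
  \<open>\<epsilon>\<close>, which live in two unrelated modules.  It is the scalar part of \<open>x\<close>; the nilpotent part
  contributes nothing on either side.
\<close>

lemma trace_tuple_End_scalar:
  assumes K: "domain K" and tt: "trace_tuple K C P \<alpha> \<beta> \<eta> \<epsilon>" and x: "x \<in> mor C P P"
  obtains c where "c \<in> carrier K" "x \<bullet> \<eta> = c \<odot>\<^bsub>Hom C \<alpha> P\<^esub> \<eta>" "\<epsilon> \<bullet> x = c \<odot>\<^bsub>Hom C P \<beta>\<^esub> \<epsilon>"
proof -
  interpret M: module K "Hom C \<alpha> P" by (rule Hom_module)
  interpret N: module K "Hom C P \<beta>" by (rule Hom_module)
  interpret E: module K "Hom C P P" by (rule Hom_module)
  have \<eta>: "freely_generated_by K (Hom C \<alpha> P) \<eta>" "\<eta> \<in> mor C \<alpha> P"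
    and \<epsilon>: "freely_generated_by K (Hom C P \<beta>) \<epsilon>" "\<epsilon> \<in> mor C P \<beta>"
    and ai: "absolutely_indecomposable K C P" and en: "end_nilpotent C P"
    using tt by (simp_all add: trace_tuple_def)
  obtain c j where c: "c \<in> carrier K" and jJ: "j \<in> jacobson_radical (End_ring C P)"
    and x_eq: "x = j \<oplus>\<^bsub>Hom C P P\<^esub> (c \<odot>\<^bsub>Hom C P P\<^esub> Ident C P)"
    by (rule absolutely_indecomposable_decomposition[OF ai x])
  have j: "j \<in> mor C P P" using jJ by (simp add: jacobson_radical_def End_ring_def)
  have cI: "c \<odot>\<^bsub>Hom C P P\<^esub> Ident C P \<in> mor C P P" using c Ident_mor by simp
  obtain n where nil: "((\<bullet>) j ^^ n) (Ident C P) = \<zero>\<^bsub>Hom C P P\<^esub>"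
    by (rule end_nilpotent_power[OF en jJ])
  have "x \<bullet> \<eta> = c \<odot>\<^bsub>Hom C \<alpha> P\<^esub> \<eta>"
    using Comp_add_left[OF j cI \<eta>(2)] nilpotent_kills_generator_right[OF K j nil \<eta>(1)]
      Comp_smult_left[OF c Ident_mor \<eta>(2)] Comp_Ident_left[OF \<eta>(2)] c \<eta>(2)
    by (simp add: x_eq)
  moreover have "\<epsilon> \<bullet> x = c \<odot>\<^bsub>Hom C P \<beta>\<^esub> \<epsilon>"
    using Comp_add_right[OF \<epsilon>(2) j cI] nilpotent_kills_generator_left[OF K j nil \<epsilon>(1)]
      Comp_smult_right[OF c \<epsilon>(2) Ident_mor] Comp_Ident_right[OF \<epsilon>(2)] c \<epsilon>(2)
    by (simp add: x_eq)
  ultimately show thesis using that c by blast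
qed

end


section \<open>The trace of a trace tuple\<close>

locale pivotal_trace_tuple = pivotal_category K C + K: domain K
  for K :: "('k, 'r) ring_scheme" and C :: "('o, 'm, 'k) pivotal_data" (structure) +
  fixes P \<alpha> \<beta> :: 'o and \<eta> \<epsilon> :: 'm
  assumes trace_tuple: "trace_tuple K C P \<alpha> \<beta> \<eta> \<epsilon>"
begin

lemma eta_generates: "freely_generated_by K (Hom C \<alpha> P) \<eta>"
  and eps_generates: "freely_generated_by K (Hom C P \<beta>) \<epsilon>"
  and eta_mor: "\<eta> \<in> mor C \<alpha> P"
  and eps_mor: "\<epsilon> \<in> mor C P \<beta>"
  using trace_tuple by (simp_all add: trace_tuple_def)

lemma coordinate_eta:
  assumes "c \<in> carrier K" shows "coordinate K (Hom C \<alpha> P) \<eta> (c \<odot>\<^bsub>Hom C \<alpha> P\<^esub> \<eta>) = c"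
  by (rule coordinate_smult[OF eta_generates assms])
    (rule module.smult_closed[OF Hom_module assms eta_mor])

lemma coordinate_eps:
  assumes "c \<in> carrier K" shows "coordinate K (Hom C P \<beta>) \<epsilon> (c \<odot>\<^bsub>Hom C P \<beta>\<^esub> \<epsilon>) = c"
  by (rule coordinate_smult[OF eps_generates assms])
    (rule module.smult_closed[OF Hom_module assms eps_mor])

text \<open>
  Both partial traces come from that of the single morphism \<open>h = \<tau> \<bullet> f \<bullet> \<sigma>\<close>, an endomorphism of
  \<open>P \<otimes> V\<close>: cancelling \<open>\<sigma>\<close> against \<open>\<eta>\<close> gives \<open>tr(\<tau> \<bullet> f) = tr(h) \<bullet> \<eta>\<close>, cancelling \<open>\<tau>\<close> against \<open>\<epsilon>\<close> gives
  \<open>tr(f \<bullet> \<sigma>) = \<epsilon> \<bullet> tr(h)\<close>.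
\<close>

lemma partial_traces_agree:
  assumes f: "f \<in> mor C (\<alpha> \<otimes>\<^sub>o V) (\<beta> \<otimes>\<^sub>o V)"
    and \<tau>: "\<tau> \<in> taus C P \<beta> \<epsilon> V" and \<sigma>: "\<sigma> \<in> sigmas C P \<alpha> \<eta> V"
  obtains c where "c \<in> carrier K"
    "partial_trace C \<alpha> P V (\<tau> \<bullet> f) = c \<odot>\<^bsub>Hom C \<alpha> P\<^esub> \<eta>"
    "partial_trace C P \<beta> V (f \<bullet> \<sigma>) = c \<odot>\<^bsub>Hom C P \<beta>\<^esub> \<epsilon>"
proof -
  have t: "\<tau> \<in> mor C (\<beta> \<otimes>\<^sub>o V) (P \<otimes>\<^sub>o V)"
    and et: "(\<epsilon> \<otimes>\<^sub>m Ident C V) \<bullet> \<tau> = Ident C (\<beta> \<otimes>\<^sub>o V)"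
    using \<tau> by (simp_all add: taus_def)
  have s: "\<sigma> \<in> mor C (P \<otimes>\<^sub>o V) (\<alpha> \<otimes>\<^sub>o V)"
    and se: "\<sigma> \<bullet> (\<eta> \<otimes>\<^sub>m Ident C V) = Ident C (\<alpha> \<otimes>\<^sub>o V)"
    using \<sigma> by (simp_all add: sigmas_def)
  let ?h = "\<tau> \<bullet> f \<bullet> \<sigma>"
  have tf: "\<tau> \<bullet> f \<in> mor C (\<alpha> \<otimes>\<^sub>o V) (P \<otimes>\<^sub>o V)" and fs: "f \<bullet> \<sigma> \<in> mor C (P \<otimes>\<^sub>o V) (\<beta> \<otimes>\<^sub>o V)"
    and h: "?h \<in> mor C (P \<otimes>\<^sub>o V) (P \<otimes>\<^sub>o V)"
    using t f s by (blast intro: Comp_mor)+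
  have eV: "\<eta> \<otimes>\<^sub>m Ident C V \<in> mor C (\<alpha> \<otimes>\<^sub>o V) (P \<otimes>\<^sub>o V)"
    and eV': "\<epsilon> \<otimes>\<^sub>m Ident C V \<in> mor C (P \<otimes>\<^sub>o V) (\<beta> \<otimes>\<^sub>o V)"
    by (rule whisker_right_mor[OF eta_mor], rule whisker_right_mor[OF eps_mor])
  have "?h \<bullet> (\<eta> \<otimes>\<^sub>m Ident C V) = \<tau> \<bullet> f"
    using Comp_assoc[OF tf s eV] se Comp_Ident_right[OF tf] by simp
  then have tr1: "partial_trace C \<alpha> P V (\<tau> \<bullet> f) = partial_trace C P P V ?h \<bullet> \<eta>"
    using partial_trace_Comp_right[OF h eta_mor] by simp
  have "(\<epsilon> \<otimes>\<^sub>m Ident C V) \<bullet> ?h = f \<bullet> \<sigma>"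
    using Comp_assoc[OF t f s] Comp_assoc[OF eV' t fs, symmetric] et Comp_Ident_left[OF fs] by simp
  then have tr2: "partial_trace C P \<beta> V (f \<bullet> \<sigma>) = \<epsilon> \<bullet> partial_trace C P P V ?h"
    using partial_trace_Comp_left[OF h eps_mor] by simp
  show thesis
    by (rule trace_tuple_End_scalar[OF K.domain_axioms trace_tuple partial_trace_mor[OF h]])
      (use tr1 tr2 that in metis)
qed

abbreviation "I \<equiv> tuple_ideal C P \<alpha> \<beta> \<eta> \<epsilon>"
abbreviation "t \<equiv> tuple_trace K C P \<alpha> \<beta> \<eta> \<epsilon>"

text \<open>
  Independence of the choices: every \<open>\<tau>\<close> yields the scalar of one fixed \<open>\<sigma>\<close>, and every \<open>\<sigma>\<close> that of
  one fixed \<open>\<tau>\<close>, so all of them yield the same one.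
\<close>

lemma tuple_trace_characterization:
  assumes V: "V \<in> I" and f: "f \<in> mor C (\<alpha> \<otimes>\<^sub>o V) (\<beta> \<otimes>\<^sub>o V)"
  shows "t V f \<in> carrier K"
    and "\<tau> \<in> taus C P \<beta> \<epsilon> V \<Longrightarrow>
      partial_trace C \<alpha> P V (\<tau> \<bullet> f) = t V f \<odot>\<^bsub>Hom C \<alpha> P\<^esub> \<eta>"
    and "\<sigma> \<in> sigmas C P \<alpha> \<eta> V \<Longrightarrow>
      partial_trace C P \<beta> V (f \<bullet> \<sigma>) = t V f \<odot>\<^bsub>Hom C P \<beta>\<^esub> \<epsilon>"
proof -
  obtain \<tau>0 \<sigma>0 where \<tau>0: "\<tau>0 \<in> taus C P \<beta> \<epsilon> V" and \<sigma>0: "\<sigma>0 \<in> sigmas C P \<alpha> \<eta> V"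
    using V by (auto simp: tuple_ideal_def lower_ideal_def upper_ideal_def)
  obtain c where c: "c \<in> carrier K"
    and c1: "partial_trace C \<alpha> P V (\<tau>0 \<bullet> f) = c \<odot>\<^bsub>Hom C \<alpha> P\<^esub> \<eta>"
    and c2: "partial_trace C P \<beta> V (f \<bullet> \<sigma>0) = c \<odot>\<^bsub>Hom C P \<beta>\<^esub> \<epsilon>"
    by (rule partial_traces_agree[OF f \<tau>0 \<sigma>0])
  have \<tau>: "partial_trace C \<alpha> P V (\<tau> \<bullet> f) = c \<odot>\<^bsub>Hom C \<alpha> P\<^esub> \<eta>" if "\<tau> \<in> taus C P \<beta> \<epsilon> V" for \<tau>
    by (rule partial_traces_agree[OF f that \<sigma>0]) (use c c2 coordinate_eps in metis)
  have \<sigma>: "partial_trace C P \<beta> V (f \<bullet> \<sigma>) = c \<odot>\<^bsub>Hom C P \<beta>\<^esub> \<epsilon>" if "\<sigma> \<in> sigmas C P \<alpha> \<eta> V" for \<sigma>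
    by (rule partial_traces_agree[OF f \<tau>0 that]) (use c c1 coordinate_eta in metis)
  have "t V f = c"
    unfolding tuple_trace_def
    by (rule the_equality) (use c \<tau> \<sigma> \<tau>0 coordinate_eta coordinate_eps in auto)
  then show "t V f \<in> carrier K"
    and "\<tau> \<in> taus C P \<beta> \<epsilon> V \<Longrightarrow> partial_trace C \<alpha> P V (\<tau> \<bullet> f) = t V f \<odot>\<^bsub>Hom C \<alpha> P\<^esub> \<eta>"
    and "\<sigma> \<in> sigmas C P \<alpha> \<eta> V \<Longrightarrow> partial_trace C P \<beta> V (f \<bullet> \<sigma>) = t V f \<odot>\<^bsub>Hom C P \<beta>\<^esub> \<epsilon>"
    using c \<tau> \<sigma> by simp_all
qed

lemma obtain_tau:
  assumes "V \<in> I"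
  obtains \<tau> where "\<tau> \<in> taus C P \<beta> \<epsilon> V" "\<tau> \<in> mor C (\<beta> \<otimes>\<^sub>o V) (P \<otimes>\<^sub>o V)"
    "(\<epsilon> \<otimes>\<^sub>m Ident C V) \<bullet> \<tau> = Ident C (\<beta> \<otimes>\<^sub>o V)"
  using assms by (auto simp: tuple_ideal_def upper_ideal_def taus_def)

lemma obtain_sigma:
  assumes "V \<in> I"
  obtains \<sigma> where "\<sigma> \<in> sigmas C P \<alpha> \<eta> V" "\<sigma> \<in> mor C (P \<otimes>\<^sub>o V) (\<alpha> \<otimes>\<^sub>o V)"
    "\<sigma> \<bullet> (\<eta> \<otimes>\<^sub>m Ident C V) = Ident C (\<alpha> \<otimes>\<^sub>o V)"
  using assms by (auto simp: tuple_ideal_def lower_ideal_def sigmas_def)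

lemma fixes_eta_iff_fixes_eps:
  assumes e: "e \<in> mor C P P"
  shows "e \<bullet> \<eta> = \<eta> \<longleftrightarrow> \<epsilon> \<bullet> e = \<epsilon>"
proof -
  interpret M: module K "Hom C \<alpha> P" by (rule Hom_module)
  interpret N: module K "Hom C P \<beta>" by (rule Hom_module)
  obtain c where c: "c \<in> carrier K" "e \<bullet> \<eta> = c \<odot>\<^bsub>Hom C \<alpha> P\<^esub> \<eta>" "\<epsilon> \<bullet> e = c \<odot>\<^bsub>Hom C P \<beta>\<^esub> \<epsilon>"
    by (rule trace_tuple_End_scalar[OF K.domain_axioms trace_tuple e])
  have "e \<bullet> \<eta> = \<eta> \<longleftrightarrow> c = \<one>\<^bsub>K\<^esub>"
    using c coordinate_eta[of c] coordinate_eta[of "\<one>\<^bsub>K\<^esub>"] M.smult_one[OF eta_mor] K.one_closed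
    by metis
  moreover have "\<epsilon> \<bullet> e = \<epsilon> \<longleftrightarrow> c = \<one>\<^bsub>K\<^esub>"
    using c coordinate_eps[of c] coordinate_eps[of "\<one>\<^bsub>K\<^esub>"] N.smult_one[OF eps_mor] K.one_closed
    by metis
  ultimately show ?thesis by simp
qed


section \<open>Normalization and uniqueness\<close>

text \<open>
  With \<open>e = (P \<otimes> \<epsilon>) \<bullet> \<tau>\<close>, sliding \<open>\<epsilon>\<close> around the loop gives \<open>tr(\<tau> \<bullet> (\<eta> \<otimes> \<epsilon>)) = e \<bullet> \<eta>\<close>.  The defining
  property of \<open>\<tau>\<close> concerns \<open>\<epsilon> \<otimes> P\<close> rather than \<open>P \<otimes> \<epsilon>\<close>, so \<open>e\<close> need not be the identity; but one
  more \<open>\<epsilon>\<close> on the left makes the two indistinguishable, and \<open>\<epsilon> \<bullet> e = \<epsilon>\<close>.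
\<close>

lemma tuple_trace_eta_eps:
  assumes \<beta>: "\<beta> = \<I>" and P: "P \<in> I"
  shows "t P (\<eta> \<otimes>\<^sub>m \<epsilon>) = \<one>\<^bsub>K\<^esub>"
proof -
  interpret M: module K "Hom C \<alpha> P" by (rule Hom_module)
  have e: "\<epsilon> \<in> mor C P \<I>" using eps_mor \<beta> by simp
  have f: "\<eta> \<otimes>\<^sub>m \<epsilon> \<in> mor C (\<alpha> \<otimes>\<^sub>o P) P" "\<eta> \<otimes>\<^sub>m \<epsilon> \<in> mor C (\<alpha> \<otimes>\<^sub>o P) (\<beta> \<otimes>\<^sub>o P)"
    using TensM_mor[OF eta_mor e] by (simp_all add: object_simps \<beta>)
  obtain \<tau> where \<tau>: "\<tau> \<in> taus C P \<beta> \<epsilon> P" and "\<tau> \<in> mor C (\<beta> \<otimes>\<^sub>o P) (P \<otimes>\<^sub>o P)"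
    and "(\<epsilon> \<otimes>\<^sub>m Ident C P) \<bullet> \<tau> = Ident C (\<beta> \<otimes>\<^sub>o P)"
    by (rule obtain_tau[OF P])
  then have t: "\<tau> \<in> mor C P (P \<otimes>\<^sub>o P)" and et: "(\<epsilon> \<otimes>\<^sub>m Ident C P) \<bullet> \<tau> = Ident C P"
    by (simp_all add: \<beta> object_simps)
  let ?e = "(Ident C P \<otimes>\<^sub>m \<epsilon>) \<bullet> \<tau>"
  have Pe: "Ident C P \<otimes>\<^sub>m \<epsilon> \<in> mor C (P \<otimes>\<^sub>o P) P" and eP: "\<epsilon> \<otimes>\<^sub>m Ident C P \<in> mor C (P \<otimes>\<^sub>o P) P"
    and ae: "Ident C \<alpha> \<otimes>\<^sub>m \<epsilon> \<in> mor C (\<alpha> \<otimes>\<^sub>o P) \<alpha>"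
    using whisker_left_mor[OF e, of P] whisker_right_mor[OF e, of P] whisker_left_mor[OF e, of \<alpha>]
    by (simp_all add: object_simps)
  have "\<epsilon> \<bullet> ?e = (\<epsilon> \<bullet> (\<epsilon> \<otimes>\<^sub>m Ident C P)) \<bullet> \<tau>"
    using Comp_assoc[OF e Pe t] interchange_effect[OF e e] TensM_Unit_left[OF e] by simp
  also have "\<dots> = \<epsilon>"
    using Comp_assoc[OF e eP t] et Comp_Ident_right[OF e] by simp
  finally have fixed: "?e \<bullet> \<eta> = \<eta>"
    using fixes_eta_iff_fixes_eps[OF Comp_mor[OF Pe t]] by simp
  have "\<tau> \<bullet> (\<eta> \<otimes>\<^sub>m \<epsilon>) = (\<tau> \<bullet> \<eta>) \<bullet> (Ident C \<alpha> \<otimes>\<^sub>m \<epsilon>)"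
    using TensM_eq_right_first[OF eta_mor e] TensM_Unit_right[OF eta_mor]
      Comp_assoc[OF t eta_mor ae] by simp
  then have "partial_trace C \<alpha> P P (\<tau> \<bullet> (\<eta> \<otimes>\<^sub>m \<epsilon>)) = \<eta>"
    using partial_trace_slide_effect[OF Comp_mor[OF t eta_mor] e] Comp_assoc[OF Pe t eta_mor] fixed by simp
  then show ?thesis
    using tuple_trace_characterization(1,2)[OF P f(2)] \<tau>
      coordinate_eta[of "t P (\<eta> \<otimes>\<^sub>m \<epsilon>)"] coordinate_eta[of "\<one>\<^bsub>K\<^esub>"] M.smult_one[OF eta_mor]
    by simp
qed

text \<open>
  The mirror image, with \<open>e = \<sigma> \<bullet> (P \<otimes> \<eta>)\<close> and \<open>tr((\<epsilon> \<otimes> \<eta>) \<bullet> \<sigma>) = \<epsilon> \<bullet> e\<close>; now \<open>e \<bullet> \<eta> = \<eta>\<close> is the equation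
  that holds directly.
\<close>

lemma tuple_trace_eps_eta:
  assumes \<alpha>: "\<alpha> = \<I>" and P: "P \<in> I"
  shows "t P (\<epsilon> \<otimes>\<^sub>m \<eta>) = \<one>\<^bsub>K\<^esub>"
proof -
  interpret M: module K "Hom C P \<beta>" by (rule Hom_module)
  have e: "\<eta> \<in> mor C \<I> P" using eta_mor \<alpha> by simp
  have f: "\<epsilon> \<otimes>\<^sub>m \<eta> \<in> mor C P (\<beta> \<otimes>\<^sub>o P)" "\<epsilon> \<otimes>\<^sub>m \<eta> \<in> mor C (\<alpha> \<otimes>\<^sub>o P) (\<beta> \<otimes>\<^sub>o P)"
    using TensM_mor[OF eps_mor e] by (simp_all add: object_simps \<alpha>)
  obtain \<sigma> where \<sigma>: "\<sigma> \<in> sigmas C P \<alpha> \<eta> P" and "\<sigma> \<in> mor C (P \<otimes>\<^sub>o P) (\<alpha> \<otimes>\<^sub>o P)"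
    and "\<sigma> \<bullet> (\<eta> \<otimes>\<^sub>m Ident C P) = Ident C (\<alpha> \<otimes>\<^sub>o P)"
    by (rule obtain_sigma[OF P])
  then have s: "\<sigma> \<in> mor C (P \<otimes>\<^sub>o P) P" and se: "\<sigma> \<bullet> (\<eta> \<otimes>\<^sub>m Ident C P) = Ident C P"
    by (simp_all add: \<alpha> object_simps)
  let ?e = "\<sigma> \<bullet> (Ident C P \<otimes>\<^sub>m \<eta>)"
  have Pe: "Ident C P \<otimes>\<^sub>m \<eta> \<in> mor C P (P \<otimes>\<^sub>o P)" and eP: "\<eta> \<otimes>\<^sub>m Ident C P \<in> mor C P (P \<otimes>\<^sub>o P)"
    and be: "Ident C \<beta> \<otimes>\<^sub>m \<eta> \<in> mor C \<beta> (\<beta> \<otimes>\<^sub>o P)"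
    using whisker_left_mor[OF e, of P] whisker_right_mor[OF e, of P] whisker_left_mor[OF e, of \<beta>]
    by (simp_all add: object_simps)
  have "?e \<bullet> \<eta> = \<sigma> \<bullet> ((\<eta> \<otimes>\<^sub>m Ident C P) \<bullet> \<eta>)"
    using Comp_assoc[OF s Pe e] interchange_state[OF e e] TensM_Unit_left[OF e] by simp
  also have "\<dots> = \<eta>"
    using Comp_assoc[OF s eP e] se Comp_Ident_left[OF e] by simp
  finally have fixed: "\<epsilon> \<bullet> ?e = \<epsilon>"
    using fixes_eta_iff_fixes_eps[OF Comp_mor[OF s Pe]] by simp
  have "(\<epsilon> \<otimes>\<^sub>m \<eta>) \<bullet> \<sigma> = (Ident C \<beta> \<otimes>\<^sub>m \<eta>) \<bullet> (\<epsilon> \<bullet> \<sigma>)"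
    using TensM_eq_left_first[OF eps_mor e] TensM_Unit_right[OF eps_mor]
      Comp_assoc[OF be eps_mor s] by simp
  then have "partial_trace C P \<beta> P ((\<epsilon> \<otimes>\<^sub>m \<eta>) \<bullet> \<sigma>) = \<epsilon>"
    using partial_trace_slide_state[OF Comp_mor[OF eps_mor s] e] Comp_assoc[OF eps_mor s Pe] fixed by simp
  then show ?thesis
    using tuple_trace_characterization(1,3)[OF P f(2)] \<sigma>
      coordinate_eps[of "t P (\<epsilon> \<otimes>\<^sub>m \<eta>)"] coordinate_eps[of "\<one>\<^bsub>K\<^esub>"] M.smult_one[OF eps_mor]
    by simp
qed

end

lemma
  assumes "right_trace K C \<alpha> \<beta> I t"
  shows right_trace_ideal: "V \<in> I \<Longrightarrow> TensO C V W \<in> I"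
    and right_trace_value:
      "\<lbrakk>V \<in> I; f \<in> mor C (TensO C \<alpha> V) (TensO C \<beta> V)\<rbrakk> \<Longrightarrow> t V f \<in> carrier K"
    and right_trace_smult:
      "\<lbrakk>V \<in> I; c \<in> carrier K; f \<in> mor C (TensO C \<alpha> V) (TensO C \<beta> V)\<rbrakk>
        \<Longrightarrow> t V (c \<odot>\<^bsub>Hom C (TensO C \<alpha> V) (TensO C \<beta> V)\<^esub> f) = c \<otimes>\<^bsub>K\<^esub> t V f"
    and right_trace_partial:
      "\<lbrakk>U \<in> I; f \<in> mor C (TensO C \<alpha> (TensO C U W)) (TensO C \<beta> (TensO C U W))\<rbrakk>
        \<Longrightarrow> t (TensO C U W) f = t U (partial_trace C (TensO C \<alpha> U) (TensO C \<beta> U) W f)"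
    and right_trace_cyclic:
      "\<lbrakk>U \<in> I; V \<in> I; f \<in> mor C (TensO C \<alpha> V) (TensO C \<beta> U); g \<in> mor C U V\<rbrakk>
        \<Longrightarrow> t V (Comp C (TensM C (Ident C \<beta>) g) f) = t U (Comp C f (TensM C (Ident C \<alpha>) g))"
  using assms by (simp_all add: right_trace_def right_ideal_def)

context pivotal_trace_tuple
begin

text \<open>
  The choice of \<open>\<tau>\<close> trades \<open>V\<close> for \<open>P \<otimes> V\<close>: cyclicity for \<open>\<epsilon> \<otimes> V : P \<otimes> V \<rightarrow> V\<close>, which exists only
  because \<open>\<beta>\<close> is the unit, turns \<open>t'\<^sub>V(f)\<close> into \<open>t'\<close> at \<open>P \<otimes> V\<close>, and the partial trace over \<open>V\<close> then
  leaves a multiple of \<open>\<eta> \<otimes> \<epsilon>\<close>.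
\<close>

lemma right_trace_unique_upper_unit:
  assumes \<beta>: "\<beta> = \<I>" and P: "P \<in> I" and t': "right_trace K C \<alpha> \<I> I t'"
    and V: "V \<in> I" and f: "f \<in> mor C (\<alpha> \<otimes>\<^sub>o V) (\<I> \<otimes>\<^sub>o V)"
  shows "t' V f = t' P (\<eta> \<otimes>\<^sub>m \<epsilon>) \<otimes>\<^bsub>K\<^esub> t V f"
proof -
  have e: "\<epsilon> \<in> mor C P \<I>" using eps_mor \<beta> by simp
  have f': "f \<in> mor C (\<alpha> \<otimes>\<^sub>o V) V" "f \<in> mor C (\<alpha> \<otimes>\<^sub>o V) (\<beta> \<otimes>\<^sub>o V)"
    using f \<beta> by (simp_all add: object_simps)
  obtain \<tau> where \<tau>: "\<tau> \<in> taus C P \<beta> \<epsilon> V" and "\<tau> \<in> mor C (\<beta> \<otimes>\<^sub>o V) (P \<otimes>\<^sub>o V)"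
    and "(\<epsilon> \<otimes>\<^sub>m Ident C V) \<bullet> \<tau> = Ident C (\<beta> \<otimes>\<^sub>o V)"
    by (rule obtain_tau[OF V])
  then have t: "\<tau> \<in> mor C V (P \<otimes>\<^sub>o V)" and et: "(\<epsilon> \<otimes>\<^sub>m Ident C V) \<bullet> \<tau> = Ident C V"
    by (simp_all add: \<beta> object_simps)
  define c where "c = t V f"
  have c: "c \<in> carrier K" "partial_trace C \<alpha> P V (\<tau> \<bullet> f) = c \<odot>\<^bsub>Hom C \<alpha> P\<^esub> \<eta>"
    using tuple_trace_characterization(1,2)[OF V f'(2)] \<tau> by (simp_all add: c_def)
  have tf: "\<tau> \<bullet> f \<in> mor C (\<alpha> \<otimes>\<^sub>o V) (P \<otimes>\<^sub>o V)" by (rule Comp_mor[OF t f'(1)])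
  have eV: "\<epsilon> \<otimes>\<^sub>m Ident C V \<in> mor C (P \<otimes>\<^sub>o V) V" and ae: "Ident C \<alpha> \<otimes>\<^sub>m \<epsilon> \<in> mor C (\<alpha> \<otimes>\<^sub>o P) \<alpha>"
    using whisker_right_mor[OF e, of V] whisker_left_mor[OF e, of \<alpha>] by (simp_all add: object_simps)
  have aeV: "Ident C \<alpha> \<otimes>\<^sub>m (\<epsilon> \<otimes>\<^sub>m Ident C V) = (Ident C \<alpha> \<otimes>\<^sub>m \<epsilon>) \<otimes>\<^sub>m Ident C V"
    using TensM_assoc[OF Ident_mor e Ident_mor] by simp
  have aeV_mor: "(Ident C \<alpha> \<otimes>\<^sub>m \<epsilon>) \<otimes>\<^sub>m Ident C V \<in> mor C (\<alpha> \<otimes>\<^sub>o P \<otimes>\<^sub>o V) (\<alpha> \<otimes>\<^sub>o V)"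
    using whisker_right_mor[OF ae, of V] by (simp add: object_simps)
  have PV: "P \<otimes>\<^sub>o V \<in> I" by (rule right_trace_ideal[OF t' P])
  have ee: "\<eta> \<otimes>\<^sub>m \<epsilon> = \<eta> \<bullet> (Ident C \<alpha> \<otimes>\<^sub>m \<epsilon>)"
    using TensM_eq_right_first[OF eta_mor e] TensM_Unit_right[OF eta_mor] by simp
  have ee_mor: "\<eta> \<otimes>\<^sub>m \<epsilon> \<in> mor C (\<alpha> \<otimes>\<^sub>o P) (\<I> \<otimes>\<^sub>o P)"
    using TensM_mor[OF eta_mor e] by (simp add: object_simps)
  have "(Ident C \<I> \<otimes>\<^sub>m (\<epsilon> \<otimes>\<^sub>m Ident C V)) \<bullet> (\<tau> \<bullet> f) = f"
    using TensM_Unit_left[OF eV] Comp_assoc[OF eV t f'(1)] et Comp_Ident_left[OF f'(1)] by simp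
  then have "t' V f = t' V ((Ident C \<I> \<otimes>\<^sub>m (\<epsilon> \<otimes>\<^sub>m Ident C V)) \<bullet> (\<tau> \<bullet> f))"
    by simp
  also have "\<dots> = t' (P \<otimes>\<^sub>o V) ((\<tau> \<bullet> f) \<bullet> (Ident C \<alpha> \<otimes>\<^sub>m (\<epsilon> \<otimes>\<^sub>m Ident C V)))"
    by (rule right_trace_cyclic[OF t' PV V _ eV]) (use tf in \<open>simp add: object_simps\<close>)
  also have "\<dots> = t' P (partial_trace C (\<alpha> \<otimes>\<^sub>o P) (\<I> \<otimes>\<^sub>o P) V
      ((\<tau> \<bullet> f) \<bullet> ((Ident C \<alpha> \<otimes>\<^sub>m \<epsilon>) \<otimes>\<^sub>m Ident C V)))"
    unfolding aeV
    by (rule right_trace_partial[OF t' P]) (use Comp_mor[OF tf aeV_mor] in \<open>simp add: object_simps\<close>)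
  also have "\<dots> = t' P ((c \<odot>\<^bsub>Hom C \<alpha> P\<^esub> \<eta>) \<bullet> (Ident C \<alpha> \<otimes>\<^sub>m \<epsilon>))"
    using partial_trace_Comp_right[OF tf ae] c(2) by (simp add: TensO_Unit_left)
  also have "\<dots> = t' P (c \<odot>\<^bsub>Hom C (\<alpha> \<otimes>\<^sub>o P) (\<I> \<otimes>\<^sub>o P)\<^esub> (\<eta> \<otimes>\<^sub>m \<epsilon>))"
    using Comp_smult_left[OF c(1) eta_mor ae] ee by (simp add: TensO_Unit_left)
  also have "\<dots> = c \<otimes>\<^bsub>K\<^esub> t' P (\<eta> \<otimes>\<^sub>m \<epsilon>)"
    by (rule right_trace_smult[OF t' P c(1) ee_mor])
  also have "\<dots> = t' P (\<eta> \<otimes>\<^sub>m \<epsilon>) \<otimes>\<^bsub>K\<^esub> c"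
    by (rule K.m_comm[OF c(1) right_trace_value[OF t' P ee_mor]])
  finally show ?thesis by (simp add: c_def)
qed

text \<open>
  The mirror image: \<open>\<eta> \<otimes> V : V \<rightarrow> P \<otimes> V\<close> is moved from the right of \<open>f \<bullet> \<sigma>\<close> to its left.
\<close>

lemma right_trace_unique_lower_unit:
  assumes \<alpha>: "\<alpha> = \<I>" and P: "P \<in> I" and t': "right_trace K C \<I> \<beta> I t'"
    and V: "V \<in> I" and f: "f \<in> mor C (\<I> \<otimes>\<^sub>o V) (\<beta> \<otimes>\<^sub>o V)"
  shows "t' V f = t' P (\<epsilon> \<otimes>\<^sub>m \<eta>) \<otimes>\<^bsub>K\<^esub> t V f"
proof -
  have e: "\<eta> \<in> mor C \<I> P" using eta_mor \<alpha> by simp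
  have f': "f \<in> mor C V (\<beta> \<otimes>\<^sub>o V)" "f \<in> mor C (\<alpha> \<otimes>\<^sub>o V) (\<beta> \<otimes>\<^sub>o V)"
    using f \<alpha> by (simp_all add: object_simps)
  obtain \<sigma> where \<sigma>: "\<sigma> \<in> sigmas C P \<alpha> \<eta> V" and "\<sigma> \<in> mor C (P \<otimes>\<^sub>o V) (\<alpha> \<otimes>\<^sub>o V)"
    and "\<sigma> \<bullet> (\<eta> \<otimes>\<^sub>m Ident C V) = Ident C (\<alpha> \<otimes>\<^sub>o V)"
    by (rule obtain_sigma[OF V])
  then have s: "\<sigma> \<in> mor C (P \<otimes>\<^sub>o V) V" and se: "\<sigma> \<bullet> (\<eta> \<otimes>\<^sub>m Ident C V) = Ident C V"
    by (simp_all add: \<alpha> object_simps)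
  define c where "c = t V f"
  have c: "c \<in> carrier K" "partial_trace C P \<beta> V (f \<bullet> \<sigma>) = c \<odot>\<^bsub>Hom C P \<beta>\<^esub> \<epsilon>"
    using tuple_trace_characterization(1,3)[OF V f'(2)] \<sigma> by (simp_all add: c_def)
  have fs: "f \<bullet> \<sigma> \<in> mor C (P \<otimes>\<^sub>o V) (\<beta> \<otimes>\<^sub>o V)" by (rule Comp_mor[OF f'(1) s])
  have eV: "\<eta> \<otimes>\<^sub>m Ident C V \<in> mor C V (P \<otimes>\<^sub>o V)" and be: "Ident C \<beta> \<otimes>\<^sub>m \<eta> \<in> mor C \<beta> (\<beta> \<otimes>\<^sub>o P)"
    using whisker_right_mor[OF e, of V] whisker_left_mor[OF e, of \<beta>] by (simp_all add: object_simps)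
  have beV: "Ident C \<beta> \<otimes>\<^sub>m (\<eta> \<otimes>\<^sub>m Ident C V) = (Ident C \<beta> \<otimes>\<^sub>m \<eta>) \<otimes>\<^sub>m Ident C V"
    using TensM_assoc[OF Ident_mor e Ident_mor] by simp
  have beV_mor: "(Ident C \<beta> \<otimes>\<^sub>m \<eta>) \<otimes>\<^sub>m Ident C V \<in> mor C (\<beta> \<otimes>\<^sub>o V) (\<beta> \<otimes>\<^sub>o P \<otimes>\<^sub>o V)"
    using whisker_right_mor[OF be, of V] by (simp add: object_simps)
  have PV: "P \<otimes>\<^sub>o V \<in> I" by (rule right_trace_ideal[OF t' P])
  have ee: "\<epsilon> \<otimes>\<^sub>m \<eta> = (Ident C \<beta> \<otimes>\<^sub>m \<eta>) \<bullet> \<epsilon>"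
    using TensM_eq_left_first[OF eps_mor e] TensM_Unit_right[OF eps_mor] by simp
  have ee_mor: "\<epsilon> \<otimes>\<^sub>m \<eta> \<in> mor C (\<I> \<otimes>\<^sub>o P) (\<beta> \<otimes>\<^sub>o P)"
    using TensM_mor[OF eps_mor e] by (simp add: object_simps)
  have "(f \<bullet> \<sigma>) \<bullet> (Ident C \<I> \<otimes>\<^sub>m (\<eta> \<otimes>\<^sub>m Ident C V)) = f"
    using TensM_Unit_left[OF eV] Comp_assoc[OF f'(1) s eV] se Comp_Ident_right[OF f'(1)] by simp
  then have "t' V f = t' V ((f \<bullet> \<sigma>) \<bullet> (Ident C \<I> \<otimes>\<^sub>m (\<eta> \<otimes>\<^sub>m Ident C V)))"
    by simp
  also have "\<dots> = t' (P \<otimes>\<^sub>o V) ((Ident C \<beta> \<otimes>\<^sub>m (\<eta> \<otimes>\<^sub>m Ident C V)) \<bullet> (f \<bullet> \<sigma>))"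
    by (rule right_trace_cyclic[OF t' V PV _ eV, symmetric]) (use fs in \<open>simp add: object_simps\<close>)
  also have "\<dots> = t' P (partial_trace C (\<I> \<otimes>\<^sub>o P) (\<beta> \<otimes>\<^sub>o P) V
      (((Ident C \<beta> \<otimes>\<^sub>m \<eta>) \<otimes>\<^sub>m Ident C V) \<bullet> (f \<bullet> \<sigma>)))"
    unfolding beV
    by (rule right_trace_partial[OF t' P]) (use Comp_mor[OF beV_mor fs] in \<open>simp add: object_simps\<close>)
  also have "\<dots> = t' P ((Ident C \<beta> \<otimes>\<^sub>m \<eta>) \<bullet> (c \<odot>\<^bsub>Hom C P \<beta>\<^esub> \<epsilon>))"
    using partial_trace_Comp_left[OF fs be] c(2) by (simp add: TensO_Unit_left)
  also have "\<dots> = t' P (c \<odot>\<^bsub>Hom C (\<I> \<otimes>\<^sub>o P) (\<beta> \<otimes>\<^sub>o P)\<^esub> (\<epsilon> \<otimes>\<^sub>m \<eta>))"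
    using Comp_smult_right[OF c(1) be eps_mor] ee by (simp add: TensO_Unit_left)
  also have "\<dots> = c \<otimes>\<^bsub>K\<^esub> t' P (\<epsilon> \<otimes>\<^sub>m \<eta>)"
    by (rule right_trace_smult[OF t' P c(1) ee_mor])
  also have "\<dots> = t' P (\<epsilon> \<otimes>\<^sub>m \<eta>) \<otimes>\<^bsub>K\<^esub> c"
    by (rule K.m_comm[OF c(1) right_trace_value[OF t' P ee_mor]])
  finally show ?thesis by (simp add: c_def)
qed

end

theorem theorem4p5:
  fixes K :: "('k, 'r) ring_scheme"
    and C :: "('o, 'm, 'k) pivotal_data"
    and P \<alpha> \<beta> :: 'o
    and \<eta> \<epsilon> :: 'm
    and I :: "'o set"
    and t :: "'o \<Rightarrow> 'm \<Rightarrow> 'k"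
  assumes "domain K"
    and "pivotal_category K C"
    and "trace_tuple K C P \<alpha> \<beta> \<eta> \<epsilon>"
    and "I = tuple_ideal C P \<alpha> \<beta> \<eta> \<epsilon>"
    and "P \<in> I"
    and "t = tuple_trace K C P \<alpha> \<beta> \<eta> \<epsilon>"
  shows "(\<beta> = \<I>\<^bsub>C\<^esub> \<longrightarrow>
           (\<forall>t'. right_trace K C \<alpha> \<I>\<^bsub>C\<^esub> I t' \<longrightarrow>
              (\<forall>V\<in>I. \<forall>f\<in>mor C (\<alpha> \<otimes>\<^sub>o\<^bsub>C\<^esub> V) (\<I>\<^bsub>C\<^esub> \<otimes>\<^sub>o\<^bsub>C\<^esub> V).
                 t' V f = t' P (\<eta> \<otimes>\<^sub>m\<^bsub>C\<^esub> \<epsilon>) \<otimes>\<^bsub>K\<^esub> t V f)) \<and>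
           t P (\<eta> \<otimes>\<^sub>m\<^bsub>C\<^esub> \<epsilon>) = \<one>\<^bsub>K\<^esub>)
       \<and> (\<alpha> = \<I>\<^bsub>C\<^esub> \<longrightarrow>
           (\<forall>t'. right_trace K C \<I>\<^bsub>C\<^esub> \<beta> I t' \<longrightarrow>
              (\<forall>V\<in>I. \<forall>f\<in>mor C (\<I>\<^bsub>C\<^esub> \<otimes>\<^sub>o\<^bsub>C\<^esub> V) (\<beta> \<otimes>\<^sub>o\<^bsub>C\<^esub> V).
                 t' V f = t' P (\<epsilon> \<otimes>\<^sub>m\<^bsub>C\<^esub> \<eta>) \<otimes>\<^bsub>K\<^esub> t V f)) \<and>
           t P (\<epsilon> \<otimes>\<^sub>m\<^bsub>C\<^esub> \<eta>) = \<one>\<^bsub>K\<^esub>)"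
proof -
  interpret pivotal_trace_tuple K C P \<alpha> \<beta> \<eta> \<epsilon>
    using assms(1-3) by (intro pivotal_trace_tuple.intro pivotal_trace_tuple_axioms.intro)
  show ?thesis
    using \<open>P \<in> I\<close> right_trace_unique_upper_unit right_trace_unique_lower_unit
      tuple_trace_eta_eps tuple_trace_eps_eta
    unfolding assms(4,6) by blast
qed

end
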